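(* Let $A=\ell^{1}(\mathbb{N}_{\wedge})$ be the semigroup algebra of the semigroup $(\mathbb{N},\wedge)$, where $m\wedge n=\min\{m,n\}$. For $n\in\mathbb{N}$ let $I_{n}$ be the ideal of $A$ generated by $\{\delta_{1},\dots,\delta_{n}\}$ and let $\phi_{n}:A\to\mathbb{C}$ be the character $\phi_{n}(f)=\sum_{i=n}^{\infty}f(i)$. Then: (i) for each $n\in\mathbb{N}$, $A/I_{n}$ is $\phi_{n}$-injective as a Banach left $A$-module; (ii) for each $n\in\mathbb{N}$, $A$ is $\phi_{n}$-injective as a Banach left $A$-module.
   Context: $\mathbb{N}=\{1,2,3,\dots\}$. For a semigroup $S$, $\ell^{1}(S)$ is the Banach algebra of absolutely summable functions $f:S\to\mathbb{C}$ with norm $\|f\|_1=\sum_{s}|f(s)|$ and convolution product $(f\ast g)(s)=\sum_{uv=s}f(u)g(v)$ (an empty sum is $0$); $\delta_s$ is the point mass at $s$, so $\delta_s\ast\delta_t=\delta_{st}$. $\Delta(A)$ is the set of characters of the Banach algebra $A$, i.e. non-zero (algebra) homomorphisms $A\to\mathbb{C}$. For Banach left $A$-modules $F,K$, $_{A}B(F,K)$ is the space of bounded linear left $A$-module morphisms $F\to K$. A bounded linear operator $T:F\to K$ is admissible if $\ker T$ and $\operatorname{Im}T$ are closed complemented subspaces of $F$ and $K$ respectively (equivalently, there is a bounded linear $S:K\to F$ with $T\circ S\circ T=T$). A monomorphism is an injective bounded module morphism. For a Banach left $A$-module $K$ and $\phi\in\Delta(A)$, $I(\phi,K)=\operatorname{span}\{a\cdot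 x-\phi(a)x : a\in A,\ x\in K\}$. A Banach left $A$-module $E$ is $\phi$-injective if for all Banach left $A$-modules $F,K$ and every admissible monomorphism $T\in{}_{A}B(F,K)$ with $I(\phi,K)\subseteq\operatorname{Im}T$, the map $_{A}B(K,E)\to{}_{A}B(F,E)$, $R\mapsto R\circ T$, is onto. $A$ and $A/I_n$ carry the natural left $A$-module structures given by multiplication. *)

theory Defs
  imports
    "HOL-Analysis.Abstract_Metric_Spaces"
    "HOL-Analysis.Infinite_Sum"
    "HOL-Library.FuncSet"
    "HOL-Algebra.QuotRing"
    "HOL-Algebra.Module"
begin

section \<open>Complex normed spaces\<close>

definition complex_ring :: "complex ring"
  where "complex_ring = \<lparr>carrier = UNIV, mult = (*), one = 1, zero = 0, add = (+)\<rparr>"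

text \<open>
  As for modules in HOL-Algebra, the record inherits the fields \<open>mult\<close> and \<open>one\<close> from rings.
  \<open>mult\<close> is the product when the record is used as a (not necessarily unital) algebra;
  neither field is constrained for a space or a module, and \<open>one\<close> is never used.
\<close>

record 'v normed = "(complex, 'v) module" +
  nrm :: "'v \<Rightarrow> real"

locale normed_vs = Module.module complex_ring V for V :: "('v, 'x) normed_scheme" (structure) +
  assumes nrm_nonneg: "x \<in> carrier V \<Longrightarrow> 0 \<le> nrm V x"
    and nrm_eq_0: "x \<in> carrier V \<Longrightarrow> nrm V x = 0 \<longleftrightarrow> x = \<zero>"
    and nrm_triangle: "\<lbrakk>x \<in> carrier V; y \<in> carrier V\<rbrakk> \<Longrightarrow> nrm V (x \<oplus> y) \<le> nrm V x + nrm V y"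
    and nrm_smult: "x \<in> carrier V \<Longrightarrow> nrm V (c \<odot> x) = norm c * nrm V x"

text \<open>The locale \<^locale>\<open>Metric_space\<close> wants nonnegativity and symmetry off the carrier too.\<close>

definition ndist :: "('v, 'x) normed_scheme \<Rightarrow> 'v \<Rightarrow> 'v \<Rightarrow> real"
  where "ndist V x y = (if x \<in> carrier V \<and> y \<in> carrier V then nrm V (x \<ominus>\<^bsub>V\<^esub> y) else 0)"

abbreviation ntopology :: "('v, 'x) normed_scheme \<Rightarrow> 'v topology"
  where "ntopology V \<equiv> Metric_space.mtopology (carrier V) (ndist V)"

locale banach_vs = normed_vs +
  assumes complete: "Metric_space.mcomplete (carrier V) (ndist V)"

abbreviation lin_subspace :: "('v, 'x) normed_scheme \<Rightarrow> 'v set \<Rightarrow> bool"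
  where "lin_subspace V M \<equiv> submodule M complex_ring V"

definition closed_subspace :: "('v, 'x) normed_scheme \<Rightarrow> 'v set \<Rightarrow> bool"
  where "closed_subspace V M \<longleftrightarrow> lin_subspace V M \<and> closedin (ntopology V) M"

definition complemented :: "('v, 'x) normed_scheme \<Rightarrow> 'v set \<Rightarrow> bool"
  where "complemented V M \<longleftrightarrow>
    (\<exists>N. closed_subspace V N \<and> M \<inter> N = {\<zero>\<^bsub>V\<^esub>} \<and> M <+>\<^bsub>V\<^esub> N = carrier V)"

definition lin_span :: "('v, 'x) normed_scheme \<Rightarrow> 'v set \<Rightarrow> 'v set"
  where "lin_span V X = lin_subspace V hull X"

definition bounded_linear_maps ::
    "('v, 'x) normed_scheme \<Rightarrow> ('w, 'y) normed_scheme \<Rightarrow> ('v \<Rightarrow> 'w) set"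
  where "bounded_linear_maps V W = {T \<in> carrier V \<rightarrow>\<^sub>E carrier W.
    (\<forall>x\<in>carrier V. \<forall>y\<in>carrier V. T (x \<oplus>\<^bsub>V\<^esub> y) = T x \<oplus>\<^bsub>W\<^esub> T y) \<and>
    (\<forall>c. \<forall>x\<in>carrier V. T (c \<odot>\<^bsub>V\<^esub> x) = c \<odot>\<^bsub>W\<^esub> T x) \<and>
    (\<exists>C. \<forall>x\<in>carrier V. nrm W (T x) \<le> C * nrm V x)}"

definition admissible ::
    "('v, 'x) normed_scheme \<Rightarrow> ('w, 'y) normed_scheme \<Rightarrow> ('v \<Rightarrow> 'w) \<Rightarrow> bool"
  where "admissible V W T \<longleftrightarrow> T \<in> bounded_linear_maps V W \<and>
    closed_subspace V (a_kernel V W T) \<and> complemented V (a_kernel V W T) \<and>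
    closed_subspace W (T ` carrier V) \<and> complemented W (T ` carrier V)"


section \<open>Banach algebras and Banach left modules\<close>

locale banach_algebra = banach_vs A for A :: "('a, 'x) normed_scheme" (structure) +
  assumes mult_closed: "\<lbrakk>a \<in> carrier A; b \<in> carrier A\<rbrakk> \<Longrightarrow> a \<otimes> b \<in> carrier A"
    and mult_assoc: "\<lbrakk>a \<in> carrier A; b \<in> carrier A; c \<in> carrier A\<rbrakk>
      \<Longrightarrow> (a \<otimes> b) \<otimes> c = a \<otimes> (b \<otimes> c)"
    and mult_add_left: "\<lbrakk>a \<in> carrier A; b \<in> carrier A; c \<in> carrier A\<rbrakk>
      \<Longrightarrow> (a \<oplus> b) \<otimes> c = a \<otimes> c \<oplus> b \<otimes> c"
    and mult_add_right: "\<lbrakk>a \<in> carrier A; b \<in> carrier A; c \<in> carrier A\<rbrakk>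
      \<Longrightarrow> a \<otimes> (b \<oplus> c) = a \<otimes> b \<oplus> a \<otimes> c"
    and mult_smult_left: "\<lbrakk>a \<in> carrier A; b \<in> carrier A\<rbrakk> \<Longrightarrow> (z \<odot> a) \<otimes> b = z \<odot> (a \<otimes> b)"
    and mult_smult_right: "\<lbrakk>a \<in> carrier A; b \<in> carrier A\<rbrakk> \<Longrightarrow> a \<otimes> (z \<odot> b) = z \<odot> (a \<otimes> b)"
    and nrm_mult: "\<lbrakk>a \<in> carrier A; b \<in> carrier A\<rbrakk> \<Longrightarrow> nrm A (a \<otimes> b) \<le> nrm A a * nrm A b"

definition characters :: "('a, 'x) normed_scheme \<Rightarrow> ('a \<Rightarrow> complex) set"
  where "characters A = {\<phi>.
    (\<forall>a\<in>carrier A. \<forall>b\<in>carrier A. \<phi> (a \<oplus>\<^bsub>A\<^esub> b) = \<phi> a + \<phi> b) \<and>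
    (\<forall>c. \<forall>a\<in>carrier A. \<phi> (c \<odot>\<^bsub>A\<^esub> a) = c * \<phi> a) \<and>
    (\<forall>a\<in>carrier A. \<forall>b\<in>carrier A. \<phi> (a \<otimes>\<^bsub>A\<^esub> b) = \<phi> a * \<phi> b) \<and>
    (\<exists>a\<in>carrier A. \<phi> a \<noteq> 0)}"

definition alg_ideal :: "('a, 'x) normed_scheme \<Rightarrow> 'a set \<Rightarrow> bool"
  where "alg_ideal A I \<longleftrightarrow> lin_subspace A I \<and>
    (\<forall>a\<in>carrier A. \<forall>x\<in>I. a \<otimes>\<^bsub>A\<^esub> x \<in> I \<and> x \<otimes>\<^bsub>A\<^esub> a \<in> I)"

definition ideal_generated :: "('a, 'x) normed_scheme \<Rightarrow> 'a set \<Rightarrow> 'a set"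
  where "ideal_generated A X = alg_ideal A hull X"

record ('a, 'v) normed_module = "'v normed" +
  act :: "'a \<Rightarrow> 'v \<Rightarrow> 'v"

text \<open>The action is only required to be jointly continuous, not contractive.\<close>

locale banach_left_module = A: banach_algebra A + E: banach_vs E
  for A :: "('a, 'x) normed_scheme" and E :: "('a, 'v, 'y) normed_module_scheme" +
  assumes act_closed: "\<lbrakk>a \<in> carrier A; x \<in> carrier E\<rbrakk> \<Longrightarrow> act E a x \<in> carrier E"
    and act_assoc: "\<lbrakk>a \<in> carrier A; b \<in> carrier A; x \<in> carrier E\<rbrakk>
      \<Longrightarrow> act E (a \<otimes>\<^bsub>A\<^esub> b) x = act E a (act E b x)"
    and act_add_left: "\<lbrakk>a \<in> carrier A; b \<in> carrier A; x \<in> carrier E\<rbrakk>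
      \<Longrightarrow> act E (a \<oplus>\<^bsub>A\<^esub> b) x = act E a x \<oplus>\<^bsub>E\<^esub> act E b x"
    and act_add_right: "\<lbrakk>a \<in> carrier A; x \<in> carrier E; y \<in> carrier E\<rbrakk>
      \<Longrightarrow> act E a (x \<oplus>\<^bsub>E\<^esub> y) = act E a x \<oplus>\<^bsub>E\<^esub> act E a y"
    and act_smult_left: "\<lbrakk>a \<in> carrier A; x \<in> carrier E\<rbrakk>
      \<Longrightarrow> act E (z \<odot>\<^bsub>A\<^esub> a) x = z \<odot>\<^bsub>E\<^esub> act E a x"
    and act_smult_right: "\<lbrakk>a \<in> carrier A; x \<in> carrier E\<rbrakk>
      \<Longrightarrow> act E a (z \<odot>\<^bsub>E\<^esub> x) = z \<odot>\<^bsub>E\<^esub> act E a x"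
    and act_bounded: "\<exists>C. \<forall>a\<in>carrier A. \<forall>x\<in>carrier E. nrm E (act E a x) \<le> C * nrm A a * nrm E x"

definition left_module_maps :: "('a, 'x) normed_scheme \<Rightarrow> ('a, 'v, 'y) normed_module_scheme \<Rightarrow>
    ('a, 'w, 'z) normed_module_scheme \<Rightarrow> ('v \<Rightarrow> 'w) set"
  where "left_module_maps A F K = {T \<in> bounded_linear_maps F K.
    \<forall>a\<in>carrier A. \<forall>x\<in>carrier F. T (act F a x) = act K a (T x)}"

definition regular_module :: "'a normed \<Rightarrow> ('a, 'a) normed_module"
  where "regular_module A = \<lparr>carrier = carrier A, mult = mult A, one = one A, zero = zero A,
    add = add A, smult = smult A, nrm = nrm A, act = mult A\<rparr>"

definition quotient_module :: "('a, 'v) normed_module \<Rightarrow> 'v set \<Rightarrow> ('a, 'v set) normed_module"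
  where "quotient_module E N = \<lparr>
    carrier = a_rcosets\<^bsub>E\<^esub> N,
    mult = rcoset_mult E N,
    one = N +>\<^bsub>E\<^esub> \<one>\<^bsub>E\<^esub>,
    zero = N,
    add = set_add E,
    smult = (\<lambda>c X. \<Union>x\<in>X. N +>\<^bsub>E\<^esub> (c \<odot>\<^bsub>E\<^esub> x)),
    nrm = (\<lambda>X. INF x\<in>X. nrm E x),
    act = (\<lambda>a X. \<Union>x\<in>X. N +>\<^bsub>E\<^esub> act E a x)\<rparr>"


section \<open>\<phi>-injectivity\<close>

definition phi_span ::
    "('a, 'x) normed_scheme \<Rightarrow> ('a \<Rightarrow> complex) \<Rightarrow> ('a, 'v, 'y) normed_module_scheme \<Rightarrow> 'v set"
  where "phi_span A \<phi> K =
    lin_span K {act K a x \<ominus>\<^bsub>K\<^esub> \<phi> a \<odot>\<^bsub>K\<^esub> x | a x. a \<in> carrier A \<and> x \<in> carrier K}"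

text \<open>
  A definition in HOL cannot quantify over types, so the types of the elements of the test
  modules \<open>F\<close> and \<open>K\<close> are parameters. A theorem concluding
  \<open>phi_injective TYPE('f) TYPE('k) A \<phi> E\<close> for type variables \<open>'f\<close>, \<open>'k\<close> covers
  all test modules. The maps in \<^const>\<open>left_module_maps\<close> are extensional, hence
  \<^const>\<open>compose\<close> for \<open>R \<circ> T\<close>.
\<close>

definition phi_injective :: "'f itself \<Rightarrow> 'k itself \<Rightarrow>
    'a normed \<Rightarrow> ('a \<Rightarrow> complex) \<Rightarrow> ('a, 'e) normed_module \<Rightarrow> bool"
  where "phi_injective TYPE('f) TYPE('k) A \<phi> E \<longleftrightarrow>
    \<phi> \<in> characters A \<and> banach_left_module A E \<and>
    (\<forall>(F :: ('a, 'f) normed_module) (K :: ('a, 'k) normed_module) T.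
      banach_left_module A F \<longrightarrow> banach_left_module A K \<longrightarrow>
      T \<in> left_module_maps A F K \<longrightarrow> inj_on T (carrier F) \<longrightarrow> admissible F K T \<longrightarrow>
      phi_span A \<phi> K \<subseteq> T ` carrier F \<longrightarrow>
      (\<lambda>R. compose (carrier F) R T) ` left_module_maps A K E = left_module_maps A F E)"


section \<open>Semigroup algebras\<close>

text \<open>
  A semigroup is given by its underlying set \<open>S\<close> and its product. Functions on \<open>S\<close> are
  represented by functions on the whole type vanishing off \<open>S\<close>.
\<close>

definition ell1 :: "'s set \<Rightarrow> ('s \<Rightarrow> 's \<Rightarrow> 's) \<Rightarrow> ('s \<Rightarrow> complex) normed"
  where "ell1 S m = \<lparr>
    carrier = {f. (\<forall>s. s \<notin> S \<longrightarrow> f s = 0) \<and> (\<lambda>s. norm (f s)) summable_on S},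
    mult = (\<lambda>f g s. \<Sum>\<^sub>\<infinity>(u, v)\<in>{(u, v). u \<in> S \<and> v \<in> S \<and> m u v = s}. f u * g v),
    one = undefined,
    zero = (\<lambda>s. 0),
    add = (\<lambda>f g s. f s + g s),
    smult = (\<lambda>c f s. c * f s),
    nrm = (\<lambda>f. \<Sum>\<^sub>\<infinity>s\<in>S. norm (f s))\<rparr>"

definition point_mass :: "'s \<Rightarrow> 's \<Rightarrow> complex"
  where "point_mass s = (\<lambda>t. if t = s then 1 else 0)"

definition ell1_N_min :: "(nat \<Rightarrow> complex) normed"
  where "ell1_N_min = ell1 {1..} min"

definition I_n :: "nat \<Rightarrow> (nat \<Rightarrow> complex) set"
  where "I_n n = ideal_generated ell1_N_min (point_mass ` {1..n})"

definition phi_n :: "nat \<Rightarrow> (nat \<Rightarrow> complex) \<Rightarrow> complex"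
  where "phi_n n f = (\<Sum>\<^sub>\<infinity>i\<in>{n..}. f i)"

end

theory Submission
  imports Defs "HOL-Analysis.Urysohn"
begin

text \<open>
  Let \<open>e = \<delta>\<^sub>n - \<delta>\<^bsub>n-1\<^esub>\<close>, with \<open>\<delta>\<^sub>0 = 0\<close>. Then \<open>a e = e a = \<phi>\<^sub>n(a) e\<close> for all \<open>a\<close>, and
  \<open>\<phi>\<^sub>n(e) = 1\<close>. For a test morphism \<open>T : F \<rightarrow> K\<close> this forces \<open>(1 - e)K \<subseteq> I(\<phi>\<^sub>n, K) \<subseteq> Im T\<close>, and on
  the remaining part \<open>eK\<close> the algebra acts by scalars, so there a bounded linear extension of a
  morphism is automatically a morphism; it is obtained from a bounded left inverse of \<open>T\<close>, which
  exists by the open mapping theorem. Hence every Banach left \<open>A\<close>-module is \<open>\<phi>\<^sub>n\<close>-injective, and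
  the rest is that \<open>A\<close> is a Banach algebra and that \<open>I\<^sub>n\<close>, the functions supported on
  \<open>{1,\<dots>,n}\<close>, is closed.
\<close>

section \<open>Normed spaces on a carrier\<close>

text \<open>The choice of \<open>e\<close> comes from the characters: phi_k is 1 on the point mass
  at m if k \<le> m and 0 otherwise, so \<open>e\<close> is sent to 1 by phi_n and to 0 by every
  other phi_k. It is the idempotent that isolates phi_n. Since the algebra has no unit, 1 - e stands
  for the operator k \<mapsto> k - ek. The obstacle is that a left inverse of \<open>T\<close>
  obtained from a complement of its image is only linear. On (1 - e)K it has to agree with the
  inverse of \<open>T\<close> on its image, which is a morphism; on eK it may be any linear map,
  once its values are pushed into eF. Boundedness of the left inverse is a separate issue:
  admissibility supplies closed complementary subspaces but no bounded projection, so the bound has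
  to come from completeness through Baire's theorem. \<open>phi_injective\<close> also requires the
  target to be a Banach module. For the quotient this rests on \<open>I_n\<close> being closed,
  although it is generated purely algebraically; the explicit description of its elements settles
  this.\<close>

lemma (in abelian_group) a_inv_zero: "\<ominus> \<zero> = \<zero>"
  using minus_equality[of \<zero> \<zero>] by simp

text \<open>Registers purely additive rules with the method \<open>algebra\<close>, so that
  rearrangements of sums and differences of vectors, where no ring is present, can be left to
  it.\<close>

lemmas (in abelian_group)
  [algebra abelian_group "zero G" "add G" "a_inv G" "a_minus G"] =
  a_closed zero_closed a_inv_closed minus_closed a_assoc l_zero l_neg a_comm minus_eq
  r_zero r_neg r_neg2 r_neg1 minus_add minus_minus a_inv_zero a_lcomm

context normed_vs
begin

text \<open>The module laws mention the operations of the record \<open>complex_ring\<close>; these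
  versions speak of ordinary complex arithmetic.\<close>

lemma scale_closed [simp, intro]: "x \<in> carrier V \<Longrightarrow> c \<odot> x \<in> carrier V"
  using smult_closed[of c x] by (simp add: complex_ring_def)

lemma scale_add_left: "x \<in> carrier V \<Longrightarrow> (c + d) \<odot> x = c \<odot> x \<oplus> d \<odot> x"
  using smult_l_distr[of c d x] by (simp add: complex_ring_def)

lemma scale_add_right:
  "\<lbrakk>x \<in> carrier V; y \<in> carrier V\<rbrakk> \<Longrightarrow> c \<odot> (x \<oplus> y) = c \<odot> x \<oplus> c \<odot> y"
  using smult_r_distr[of c x y] by (simp add: complex_ring_def)

lemma scale_scale: "x \<in> carrier V \<Longrightarrow> c \<odot> (d \<odot> x) = (c * d) \<odot> x"
  using smult_assoc1[of c d x] by (simp add: complex_ring_def)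

lemma scale_one [simp]: "x \<in> carrier V \<Longrightarrow> 1 \<odot> x = x"
  using smult_one[of x] by (simp add: complex_ring_def)

lemma scale_zero_left [simp]: "x \<in> carrier V \<Longrightarrow> 0 \<odot> x = \<zero>"
  using smult_l_null[of x] by (simp add: complex_ring_def)

lemma scale_zero_right [simp]: "c \<odot> \<zero> = \<zero>"
  using smult_r_null[of c] by (simp add: complex_ring_def)

lemma scale_minus_one:
  assumes x: "x \<in> carrier V"
  shows "(- 1) \<odot> x = \<ominus> x"
proof -
  have "(- 1) \<odot> x \<oplus> x = \<zero>"
    using scale_add_left[OF x, of "- 1" 1] x by simp
  then show ?thesis
    using M.minus_equality[of "(- 1) \<odot> x" x] x by simp
qed

lemma scale_minus_right: "x \<in> carrier V \<Longrightarrow> c \<odot> (\<ominus> x) = \<ominus> (c \<odot> x)"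
  using smult_r_minus[of c x] by (simp add: complex_ring_def)

lemma scale_diff_right:
  "\<lbrakk>x \<in> carrier V; y \<in> carrier V\<rbrakk> \<Longrightarrow> c \<odot> (x \<ominus> y) = c \<odot> x \<ominus> c \<odot> y"
  by (simp add: M.minus_eq scale_add_right scale_minus_right)

lemma nrm_zero [simp]: "nrm V \<zero> = 0"
  by (simp add: nrm_eq_0)

lemma nrm_minus [simp]: "x \<in> carrier V \<Longrightarrow> nrm V (\<ominus> x) = nrm V x"
  by (metis scale_minus_one nrm_smult norm_minus_cancel norm_one mult_1)

lemma minus_diff: "\<lbrakk>x \<in> carrier V; y \<in> carrier V\<rbrakk> \<Longrightarrow> \<ominus> (x \<ominus> y) = y \<ominus> x"
  by algebra

lemma diff_add_diff:
  "\<lbrakk>x \<in> carrier V; y \<in> carrier V; z \<in> carrier V\<rbrakk> \<Longrightarrow> (x \<ominus> y) \<oplus> (y \<ominus> z) = x \<ominus> z"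
  by algebra

lemma diff_eq_zero_iff:
  assumes "x \<in> carrier V" "y \<in> carrier V"
  shows "x \<ominus> y = \<zero> \<longleftrightarrow> x = y"
  using assms by (metis M.minus_eq M.r_neg M.minus_minus M.a_inv_closed M.minus_equality)

lemma nrm_diff_commute: "\<lbrakk>x \<in> carrier V; y \<in> carrier V\<rbrakk> \<Longrightarrow> nrm V (x \<ominus> y) = nrm V (y \<ominus> x)"
  by (metis minus_diff M.minus_closed nrm_minus)

lemma nrm_diff_triangle:
  "\<lbrakk>x \<in> carrier V; y \<in> carrier V; z \<in> carrier V\<rbrakk>
    \<Longrightarrow> nrm V (x \<ominus> z) \<le> nrm V (x \<ominus> y) + nrm V (y \<ominus> z)"
  by (metis diff_add_diff nrm_triangle M.minus_closed)

lemma nrm_diff_le: "\<lbrakk>x \<in> carrier V; y \<in> carrier V\<rbrakk> \<Longrightarrow> nrm V (x \<ominus> y) \<le> nrm V x + nrm V y"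
  by (metis M.minus_eq M.a_inv_closed nrm_minus nrm_triangle)

sublocale MS: Metric_space "carrier V" "ndist V"
proof
  show "0 \<le> ndist V x y" for x y
    by (simp add: ndist_def nrm_nonneg)
  show "ndist V x y = ndist V y x" for x y
    by (simp add: ndist_def nrm_diff_commute)
  show "ndist V x y = 0 \<longleftrightarrow> x = y" if "x \<in> carrier V" "y \<in> carrier V" for x y
    using that by (simp add: ndist_def nrm_eq_0 diff_eq_zero_iff)
  show "ndist V x z \<le> ndist V x y + ndist V y z"
    if "x \<in> carrier V" "y \<in> carrier V" "z \<in> carrier V" for x y z
    using that by (simp add: ndist_def nrm_diff_triangle)
qed

lemma limitin_nrm_iff:
  assumes "\<And>n. s n \<in> carrier V"
  shows "limitin (ntopology V) s l sequentially \<longleftrightarrow>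
    l \<in> carrier V \<and> (\<lambda>n. nrm V (s n \<ominus> l)) \<longlonglongrightarrow> 0"
  using assms by (auto simp: MS.limitin_metric_dist_null ndist_def)

lemma MCauchy_nrm_iff:
  "MS.MCauchy s \<longleftrightarrow> range s \<subseteq> carrier V \<and>
    (\<forall>\<epsilon>>0. \<exists>N. \<forall>m\<ge>N. \<forall>n\<ge>N. nrm V (s m \<ominus> s n) < \<epsilon>)"
  unfolding MS.MCauchy_def by (auto simp: ndist_def image_subset_iff)

lemma MCauchy_geometric:
  assumes s: "\<And>n. s n \<in> carrier V"
    and step: "\<And>n. nrm V (s (Suc n) \<ominus> s n) \<le> C * (1 / 2) ^ n"
  shows "MS.MCauchy s" and "\<And>n. nrm V (s n \<ominus> s 0) \<le> 2 * C"
proof -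
  have C: "0 \<le> C"
    using step[of 0] nrm_nonneg[of "s (Suc 0) \<ominus> s 0"] s by simp
  \<comment> \<open>The exact partial sum of the geometric series, with its subtracted last term, is
    what lets the induction on \<open>k\<close> close.\<close>
  have tail: "nrm V (s (n + k) \<ominus> s n) \<le> 2 * C * ((1 / 2) ^ n - (1 / 2) ^ (n + k))" for n k
  proof (induction k)
    case 0
    then show ?case using s[of n] by (simp add: diff_eq_zero_iff M.minus_eq M.r_neg)
  next
    case (Suc k)
    have "nrm V (s (n + Suc k) \<ominus> s n)
        \<le> nrm V (s (Suc (n + k)) \<ominus> s (n + k)) + nrm V (s (n + k) \<ominus> s n)"
      using nrm_diff_triangle s by simp
    also have "\<dots> \<le> C * (1 / 2) ^ (n + k) + 2 * C * ((1 / 2) ^ n - (1 / 2) ^ (n + k))"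
      using step[of "n + k"] Suc by simp
    finally show ?case by (simp add: field_simps)
  qed
  show "nrm V (s n \<ominus> s 0) \<le> 2 * C" for n
  proof -
    have "2 * C * (1 - (1 / 2) ^ n) \<le> 2 * C"
      using C by (simp add: mult_left_le)
    then show ?thesis using tail[of 0 n] by simp
  qed
  have tail': "nrm V (s m \<ominus> s n) \<le> 2 * C * (1 / 2) ^ N" if "N \<le> n" "n \<le> m" for N n m
  proof -
    have "nrm V (s m \<ominus> s n) \<le> 2 * C * ((1 / 2) ^ n - (1 / 2) ^ m)"
      using tail[of n "m - n"] that by simp
    also have "\<dots> \<le> 2 * C * (1 / 2) ^ N"
      using C that by (intro mult_left_mono order_trans[OF _ power_decreasing[of N n]]) auto
    finally show ?thesis .
  qed
  have lim: "(\<lambda>N. 2 * C * (1 / 2) ^ N) \<longlonglongrightarrow> 0"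
    by (rule tendsto_mult_right_zero) (auto intro: LIMSEQ_realpow_zero)
  show "MS.MCauchy s"
    unfolding MCauchy_nrm_iff
  proof (intro conjI allI impI)
    fix \<epsilon> :: real assume "0 < \<epsilon>"
    with lim obtain N where N: "2 * C * (1 / 2) ^ N < \<epsilon>"
      by (metis (no_types, lifting) order_tendstoD(2) eventually_sequentially order_refl)
    have "nrm V (s m \<ominus> s n) < \<epsilon>" if "N \<le> m" "N \<le> n" for m n
    proof (cases "n \<le> m")
      case True
      then show ?thesis using tail'[of N n m] that N by simp
    next
      case False
      then show ?thesis using tail'[of N m n] that N nrm_diff_commute[of "s m" "s n"] s by simp
    qed
    then show "\<exists>N. \<forall>m\<ge>N. \<forall>n\<ge>N. nrm V (s m \<ominus> s n) < \<epsilon>" by blast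
  qed (use s in auto)
qed

end

text \<open>Completeness in the form used twice below: for the successive corrections in the open
  mapping argument and for lifting a Cauchy sequence from a quotient. The bound 2C is the sum of the
  geometric series and survives the passage to the limit.\<close>

lemma (in banach_vs) geometric_limit:
  assumes s: "\<And>n. s n \<in> carrier V"
    and step: "\<And>n. nrm V (s (Suc n) \<ominus> s n) \<le> C * (1 / 2) ^ n"
  obtains l where "l \<in> carrier V" "(\<lambda>n. nrm V (s n \<ominus> l)) \<longlonglongrightarrow> 0" "nrm V (l \<ominus> s 0) \<le> 2 * C"
proof -
  obtain l where l: "limitin (ntopology V) s l sequentially"
    using complete MCauchy_geometric(1)[OF assms] unfolding MS.mcomplete_def by blast
  then have lV: "l \<in> carrier V" and lim: "(\<lambda>n. nrm V (s n \<ominus> l)) \<longlonglongrightarrow> 0"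
    by (simp_all add: limitin_nrm_iff s)
  have "nrm V (l \<ominus> s 0) \<le> nrm V (s n \<ominus> l) + 2 * C" for n
    using nrm_diff_triangle[of l "s n" "s 0"] MCauchy_geometric(2)[OF assms, of n]
      nrm_diff_commute[of l "s n"] lV s by simp
  moreover have "(\<lambda>n. nrm V (s n \<ominus> l) + 2 * C) \<longlonglongrightarrow> 0 + 2 * C"
    by (intro tendsto_add lim tendsto_const)
  ultimately have "nrm V (l \<ominus> s 0) \<le> 0 + 2 * C"
    by (intro LIMSEQ_le_const) auto
  then show thesis using that lV lim by simp
qed

section \<open>Open mapping\<close>

lemma bounded_linear_mapsD:
  assumes "T \<in> bounded_linear_maps V W"
  shows "\<And>x. x \<in> carrier V \<Longrightarrow> T x \<in> carrier W"
    and "\<And>x y. \<lbrakk>x \<in> carrier V; y \<in> carrier V\<rbrakk> \<Longrightarrow> T (x \<oplus>\<^bsub>V\<^esub> y) = T x \<oplus>\<^bsub>W\<^esub> T y"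
    and "\<And>c x. x \<in> carrier V \<Longrightarrow> T (c \<odot>\<^bsub>V\<^esub> x) = c \<odot>\<^bsub>W\<^esub> T x"
    and "T \<in> extensional (carrier V)"
  using assms by (auto simp: bounded_linear_maps_def PiE_def)

text \<open>The constant in the definition may be zero or negative. Enlarging it to
  \<open>max C 1\<close> keeps the estimate because norms are nonnegative.\<close>

lemma bounded_linear_maps_bound:
  assumes "normed_vs V" "T \<in> bounded_linear_maps V W"
  obtains C where "0 < C" "\<And>x. x \<in> carrier V \<Longrightarrow> nrm W (T x) \<le> C * nrm V x"
proof -
  obtain C where C: "\<And>x. x \<in> carrier V \<Longrightarrow> nrm W (T x) \<le> C * nrm V x"
    using assms(2) unfolding bounded_linear_maps_def by blast
  have "nrm W (T x) \<le> max C 1 * nrm V x" if "x \<in> carrier V" for x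
    using C[OF that] normed_vs.nrm_nonneg[OF assms(1) that]
    by (meson order_trans mult_right_mono max.cobounded1)
  then show thesis by (intro that[of "max C 1"]) auto
qed

lemma bounded_linear_maps_diff:
  assumes "normed_vs V" "normed_vs W" "T \<in> bounded_linear_maps V W"
    and "x \<in> carrier V" "y \<in> carrier V"
  shows "T (x \<ominus>\<^bsub>V\<^esub> y) = T x \<ominus>\<^bsub>W\<^esub> T y" and "T \<zero>\<^bsub>V\<^esub> = \<zero>\<^bsub>W\<^esub>"
proof -
  interpret V: normed_vs V by fact
  interpret W: normed_vs W by fact
  note T = bounded_linear_mapsD[OF assms(3)]
  have "T (\<ominus>\<^bsub>V\<^esub> y) = \<ominus>\<^bsub>W\<^esub> T y"
    using T(3)[of y "- 1"] T(1)[of y] assms(5)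
    by (simp add: V.scale_minus_one W.scale_minus_one)
  then show "T (x \<ominus>\<^bsub>V\<^esub> y) = T x \<ominus>\<^bsub>W\<^esub> T y"
    using T(2)[of x "\<ominus>\<^bsub>V\<^esub> y"] assms(4,5) by (simp add: a_minus_def)
  show "T \<zero>\<^bsub>V\<^esub> = \<zero>\<^bsub>W\<^esub>"
    using T(3)[of "\<zero>\<^bsub>V\<^esub>" 0] T(1)[of "\<zero>\<^bsub>V\<^esub>"] by simp
qed

lemma (in normed_vs) lin_subspaceD:
  assumes "lin_subspace V M"
  shows "M \<subseteq> carrier V" "\<zero> \<in> M"
    and "\<And>x y. \<lbrakk>x \<in> M; y \<in> M\<rbrakk> \<Longrightarrow> x \<oplus> y \<in> M"
    and "\<And>x. x \<in> M \<Longrightarrow> \<ominus> x \<in> M"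
    and "\<And>x y. \<lbrakk>x \<in> M; y \<in> M\<rbrakk> \<Longrightarrow> x \<ominus> y \<in> M"
    and "\<And>c x. x \<in> M \<Longrightarrow> c \<odot> x \<in> M"
proof -
  show sub: "M \<subseteq> carrier V"
    and add: "\<And>x y. \<lbrakk>x \<in> M; y \<in> M\<rbrakk> \<Longrightarrow> x \<oplus> y \<in> M"
    and inv: "\<And>x. x \<in> M \<Longrightarrow> \<ominus> x \<in> M"
    using submoduleE[OF assms] by auto
  then show "\<And>x y. \<lbrakk>x \<in> M; y \<in> M\<rbrakk> \<Longrightarrow> x \<ominus> y \<in> M"
    by (simp add: M.minus_eq)
  show scale: "\<And>c x. x \<in> M \<Longrightarrow> c \<odot> x \<in> M"
    using submoduleE(4)[OF assms] by (simp add: complex_ring_def)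
  show "\<zero> \<in> M"
    using submoduleE(2)[OF assms] scale[of _ 0] sub by (metis all_not_in_conv scale_zero_left subsetD)
qed

lemma (in normed_vs) lin_subspaceI:
  assumes "M \<subseteq> carrier V" "\<zero> \<in> M"
    and "\<And>x y. \<lbrakk>x \<in> M; y \<in> M\<rbrakk> \<Longrightarrow> x \<oplus> y \<in> M"
    and "\<And>c x. x \<in> M \<Longrightarrow> c \<odot> x \<in> M"
  shows "lin_subspace V M"
proof (rule submoduleI)
  show "\<ominus> x \<in> M" if "x \<in> M" for x
    using assms(4)[OF that, of "- 1"] assms(1) that by (auto simp: scale_minus_one)
qed (use assms in auto)

lemma (in normed_vs) closed_subspace_limit:
  assumes "closed_subspace V M" "\<And>n. s n \<in> M" "l \<in> carrier V" "(\<lambda>n. nrm V (s n \<ominus> l)) \<longlonglongrightarrow> 0"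
  shows "l \<in> M"
proof -
  have "M \<subseteq> carrier V"
    using assms(1) lin_subspaceD(1) by (auto simp: closed_subspace_def)
  then have "limitin (ntopology V) s l sequentially"
    using assms(2-4) by (subst limitin_nrm_iff) auto
  then show ?thesis
    using assms(1,2) unfolding closed_subspace_def MS.metric_closedin_iff_sequentially_closed
    by (metis image_subset_iff)
qed

lemma (in normed_vs) closed_subspaceI:
  assumes "lin_subspace V M"
    and "\<And>s l. \<lbrakk>\<And>n. s n \<in> M; l \<in> carrier V; (\<lambda>n. nrm V (s n \<ominus> l)) \<longlonglongrightarrow> 0\<rbrakk> \<Longrightarrow> l \<in> M"
  shows "closed_subspace V M"
  unfolding closed_subspace_def MS.metric_closedin_iff_sequentially_closed
proof (intro conjI allI impI)
  show M: "M \<subseteq> carrier V" using lin_subspaceD(1)[OF assms(1)] .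
  fix s l assume *: "range s \<subseteq> M \<and> limitin (ntopology V) s l sequentially"
  then have "\<And>n. s n \<in> carrier V" using M by auto
  with * show "l \<in> M" by (intro assms(2)[of s l]) (auto simp: limitin_nrm_iff)
qed (rule assms(1))

lemma mem_set_add_iff: "z \<in> A <+>\<^bsub>G\<^esub> B \<longleftrightarrow> (\<exists>a\<in>A. \<exists>b\<in>B. z = a \<oplus>\<^bsub>G\<^esub> b)"
  by (auto simp: set_add_def')

text \<open>The setting of the open mapping theorem for the surjection (v, n) \<mapsto> Tv + n from
  V \<times> N onto W, phrased without forming the product space.\<close>

locale complemented_sum =
  V: banach_vs V + W: banach_vs W
  for V :: "('v, 'x) normed_scheme" and W :: "('w, 'y) normed_scheme" +
  fixes T N
  assumes T: "T \<in> bounded_linear_maps V W"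
    and N: "closed_subspace W N"
    and sum: "T ` carrier V <+>\<^bsub>W\<^esub> N = carrier W"
begin

lemmas T_closed [simp] = bounded_linear_mapsD(1)[OF T]
  and T_add = bounded_linear_mapsD(2)[OF T]
  and T_scale = bounded_linear_mapsD(3)[OF T]

lemmas T_diff = bounded_linear_maps_diff(1)[OF V.normed_vs_axioms W.normed_vs_axioms T]

lemma T_zero: "T \<zero>\<^bsub>V\<^esub> = \<zero>\<^bsub>W\<^esub>"
  by (rule bounded_linear_maps_diff(2)[OF V.normed_vs_axioms W.normed_vs_axioms T]) auto

lemma N_subspace: "lin_subspace W N"
  using N by (simp add: closed_subspace_def)

lemmas ND = W.lin_subspaceD[OF N_subspace]

lemma N_carrier: "n \<in> N \<Longrightarrow> n \<in> carrier W"
  using ND(1) by blast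

text \<open>The Baire half of the open mapping theorem: one constant serves all \<open>w\<close>,
  but the equation w = Tv + n is solved only up to an arbitrary tolerance. Only the component in
  \<open>V\<close> carries a norm bound.\<close>

lemma approximate_decomposition:
  obtains C where "0 < C"
    "\<And>w \<epsilon>. \<lbrakk>w \<in> carrier W; 0 < \<epsilon>\<rbrakk> \<Longrightarrow> \<exists>v\<in>carrier V. \<exists>n\<in>N.
       nrm V v \<le> C * nrm W w \<and> nrm W (w \<ominus>\<^bsub>W\<^esub> (T v \<oplus>\<^bsub>W\<^esub> n)) < \<epsilon>"
proof -
  define B where "B m = {T v \<oplus>\<^bsub>W\<^esub> n | v n. v \<in> carrier V \<and> nrm V v \<le> real m \<and> n \<in> N}" for m :: nat
  define \<G> where "\<G> = range (\<lambda>m. (ntopology W) closure_of B m)"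
  have B_sub: "B m \<subseteq> carrier W" for m
    by (auto simp: B_def N_carrier)
  have "\<Union>\<G> = carrier W"
  proof
    show "\<Union>\<G> \<subseteq> carrier W"
      using closure_of_subset_topspace[of "ntopology W"] by (auto simp: \<G>_def)
    show "carrier W \<subseteq> \<Union>\<G>"
    proof
      fix w assume "w \<in> carrier W"
      then obtain v n where "v \<in> carrier V" "n \<in> N" "w = T v \<oplus>\<^bsub>W\<^esub> n"
        unfolding sum[symmetric] mem_set_add_iff by blast
      moreover obtain m where "nrm V v \<le> real m"
        using real_arch_simple by blast
      ultimately have "w \<in> B m" by (auto simp: B_def)
      then show "w \<in> \<Union>\<G>"
        using closure_of_subset[of "B m" "ntopology W"] B_sub[of m] by (auto simp: \<G>_def)
    qed
  qed
  then have "(ntopology W) interior_of \<Union>\<G> \<noteq> {}"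
    using W.M.zero_closed by (metis W.MS.topspace_mtopology interior_of_topspace empty_iff)
  \<comment> \<open>By Baire's theorem a countable cover of the non-empty complete space
    \<open>W\<close> by closed sets has a member with interior points.\<close>
  then obtain m where "(ntopology W) interior_of ((ntopology W) closure_of B m) \<noteq> {}"
    using W.MS.metric_Baire_category_alt[OF W.complete, of \<G>] by (force simp: \<G>_def)
  then obtain y r where y: "y \<in> carrier W" and r: "0 < r"
    and ball: "W.MS.mball y r \<subseteq> (ntopology W) closure_of B m"
    by (auto simp: W.MS.metric_interior_of dest: subsetD)
  have near: "\<exists>b\<in>B m. nrm W (z \<ominus>\<^bsub>W\<^esub> b) < \<epsilon>"
    if "z \<in> carrier W" "nrm W (z \<ominus>\<^bsub>W\<^esub> y) < r" "0 < \<epsilon>" for z \<epsilon>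
  proof -
    have "z \<in> (ntopology W) closure_of B m"
      using ball that y by (auto simp: ndist_def W.nrm_diff_commute)
    then show ?thesis
      using that(3) B_sub[of m] by (fastforce simp: W.MS.metric_closure_of ndist_def)
  qed
  \<comment> \<open>This moves the ball from \<open>y\<close> to the origin: z = (y + z) - y with
    both terms in the ball, so the difference of two approximants from \<open>B m\<close>
    approximates \<open>z\<close>. Hence the bound 2m, and the tolerance \<epsilon> / 2 for each
    approximant.\<close>
  have small: "\<exists>v\<in>carrier V. \<exists>n\<in>N. nrm V v \<le> 2 * real m \<and> nrm W (z \<ominus>\<^bsub>W\<^esub> (T v \<oplus>\<^bsub>W\<^esub> n)) < \<epsilon>"
    if z: "z \<in> carrier W" "nrm W z < r" and \<epsilon>: "0 < \<epsilon>" for z \<epsilon>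
  proof -
    have "(y \<oplus>\<^bsub>W\<^esub> z) \<ominus>\<^bsub>W\<^esub> y = z" "y \<ominus>\<^bsub>W\<^esub> y = \<zero>\<^bsub>W\<^esub>" using y z(1) by algebra+
    then obtain b b' where b: "b \<in> B m" "nrm W ((y \<oplus>\<^bsub>W\<^esub> z) \<ominus>\<^bsub>W\<^esub> b) < \<epsilon> / 2"
      and b': "b' \<in> B m" "nrm W (y \<ominus>\<^bsub>W\<^esub> b') < \<epsilon> / 2"
      using near[of "y \<oplus>\<^bsub>W\<^esub> z" "\<epsilon> / 2"] near[of y "\<epsilon> / 2"] y z \<epsilon> r by auto
    obtain v n v' n' where v: "v \<in> carrier V" "nrm V v \<le> m" "n \<in> N" "b = T v \<oplus>\<^bsub>W\<^esub> n"
      and v': "v' \<in> carrier V" "nrm V v' \<le> m" "n' \<in> N" "b' = T v' \<oplus>\<^bsub>W\<^esub> n'"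
      using b(1) b'(1) unfolding B_def by blast
    have bW: "b \<in> carrier W" "b' \<in> carrier W" using b b' B_sub by auto
    have diff: "T (v \<ominus>\<^bsub>V\<^esub> v') \<oplus>\<^bsub>W\<^esub> (n \<ominus>\<^bsub>W\<^esub> n') = b \<ominus>\<^bsub>W\<^esub> b'"
    proof -
      have "T v \<in> carrier W" "T v' \<in> carrier W" "n \<in> carrier W" "n' \<in> carrier W"
        using v v' N_carrier by auto
      then show ?thesis unfolding v(4) v'(4) T_diff[OF v(1) v'(1)] by algebra
    qed
    have "z \<ominus>\<^bsub>W\<^esub> (b \<ominus>\<^bsub>W\<^esub> b') = ((y \<oplus>\<^bsub>W\<^esub> z) \<ominus>\<^bsub>W\<^esub> b) \<ominus>\<^bsub>W\<^esub> (y \<ominus>\<^bsub>W\<^esub> b')"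
      using y z(1) bW by algebra
    then have "nrm W (z \<ominus>\<^bsub>W\<^esub> (b \<ominus>\<^bsub>W\<^esub> b')) < \<epsilon>"
      using W.nrm_diff_le[of "(y \<oplus>\<^bsub>W\<^esub> z) \<ominus>\<^bsub>W\<^esub> b" "y \<ominus>\<^bsub>W\<^esub> b'"] b(2) b'(2) y z(1) bW by simp
    moreover have "nrm V (v \<ominus>\<^bsub>V\<^esub> v') \<le> 2 * real m"
      using V.nrm_diff_le[of v v'] v v' by simp
    ultimately show ?thesis
      using v(1) v'(1) ND(5)[OF v(3) v'(3)] unfolding diff[symmetric] by blast
  qed
  \<comment> \<open>A vector scaled to norm r / 2 is solved with bound 2m, and scaling back
    multiplies this by 2 / r times the norm of \<open>w\<close>. \<open>Suc m\<close> in place of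
    \<open>m\<close> keeps \<open>C\<close> positive.\<close>
  define C where "C = 4 * real (Suc m) / r"
  have "\<exists>v\<in>carrier V. \<exists>n\<in>N. nrm V v \<le> C * nrm W w \<and> nrm W (w \<ominus>\<^bsub>W\<^esub> (T v \<oplus>\<^bsub>W\<^esub> n)) < \<epsilon>"
    if w: "w \<in> carrier W" and \<epsilon>: "0 < \<epsilon>" for w \<epsilon>
  proof (cases "w = \<zero>\<^bsub>W\<^esub>")
    case True
    then show ?thesis
      using \<epsilon> ND(2) by (intro bexI[of _ "\<zero>\<^bsub>V\<^esub>"] bexI[of _ "\<zero>\<^bsub>W\<^esub>"]) (auto simp: T_zero a_minus_def)
  next
    case False
    then have pos: "0 < nrm W w"
      using w W.nrm_eq_0[of w] W.nrm_nonneg[of w] by simp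
    \<comment> \<open>The factor brings \<open>w\<close> to norm r / 2, inside the ball of radius
      \<open>r\<close>. The tolerance below is t\<epsilon>, so that it becomes \<epsilon> after
      division by \<open>t\<close>.\<close>
    define t where "t = r / (2 * nrm W w)"
    have t: "0 < t" using pos r by (simp add: t_def)
    define c where "c = complex_of_real t"
    have c: "c \<noteq> 0" "norm c = t" using t by (simp_all add: c_def)
    have "nrm W (c \<odot>\<^bsub>W\<^esub> w) < r"
      using w pos r by (simp add: W.nrm_smult c t_def)
    then obtain v n where v: "v \<in> carrier V" "nrm V v \<le> 2 * real m" and n: "n \<in> N"
      and close: "nrm W (c \<odot>\<^bsub>W\<^esub> w \<ominus>\<^bsub>W\<^esub> (T v \<oplus>\<^bsub>W\<^esub> n)) < t * \<epsilon>"
      using small[of "c \<odot>\<^bsub>W\<^esub> w" "t * \<epsilon>"] w t \<epsilon> by auto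
    have "w \<ominus>\<^bsub>W\<^esub> (T (inverse c \<odot>\<^bsub>V\<^esub> v) \<oplus>\<^bsub>W\<^esub> inverse c \<odot>\<^bsub>W\<^esub> n)
        = inverse c \<odot>\<^bsub>W\<^esub> (c \<odot>\<^bsub>W\<^esub> w \<ominus>\<^bsub>W\<^esub> (T v \<oplus>\<^bsub>W\<^esub> n))"
      using v n w c N_carrier by (simp add: T_scale W.scale_diff_right W.scale_add_right W.scale_scale)
    then have "nrm W (w \<ominus>\<^bsub>W\<^esub> (T (inverse c \<odot>\<^bsub>V\<^esub> v) \<oplus>\<^bsub>W\<^esub> inverse c \<odot>\<^bsub>W\<^esub> n)) < \<epsilon>"
      using close v n w t N_carrier
      by (simp add: W.nrm_smult norm_divide c(2) inverse_eq_divide pos_divide_less_eq mult.commute)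
    moreover have "nrm V (inverse c \<odot>\<^bsub>V\<^esub> v) \<le> C * nrm W w"
    proof -
      have "nrm V (inverse c \<odot>\<^bsub>V\<^esub> v) = nrm V v / t"
        using v c(2) by (simp add: V.nrm_smult norm_divide inverse_eq_divide)
      also have "\<dots> \<le> 2 * real (Suc m) / t"
        using v t by (intro divide_right_mono) auto
      also have "\<dots> = C * nrm W w"
        using r pos by (simp add: C_def t_def field_simps)
      finally show ?thesis .
    qed
    ultimately show ?thesis
      using v(1) ND(6)[OF n] V.scale_closed by blast
  qed
  moreover have "0 < C" using r by (simp add: C_def)
  ultimately show thesis using that by blast
qed

text \<open>Successive approximation: each step solves for the current residual and halves its
  bound, so the corrections in \<open>V\<close> are at most C 2^(-k) times the norm of
  \<open>w\<close> and add up to at most twice C times that norm. The components in \<open>N\<close>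
  need no estimate of their own: they converge because the residuals and the components in
  \<open>V\<close> do, and their limit stays in the closed set \<open>N\<close>.\<close>

theorem bounded_decomposition:
  obtains C where "0 < C"
    "\<And>w. w \<in> carrier W \<Longrightarrow> \<exists>v\<in>carrier V. nrm V v \<le> C * nrm W w \<and> w \<ominus>\<^bsub>W\<^esub> T v \<in> N"
proof -
  obtain C where C: "0 < C" and approx: "\<And>w \<epsilon>. \<lbrakk>w \<in> carrier W; 0 < \<epsilon>\<rbrakk> \<Longrightarrow> \<exists>v\<in>carrier V. \<exists>n\<in>N.
       nrm V v \<le> C * nrm W w \<and> nrm W (w \<ominus>\<^bsub>W\<^esub> (T v \<oplus>\<^bsub>W\<^esub> n)) < \<epsilon>"
    using approximate_decomposition by blast
  obtain D where D: "0 < D" "\<And>x. x \<in> carrier V \<Longrightarrow> nrm W (T x) \<le> D * nrm V x"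
    using bounded_linear_maps_bound[OF V.normed_vs_axioms T] by blast
  have "\<exists>v\<in>carrier V. nrm V v \<le> 2 * C * nrm W w \<and> w \<ominus>\<^bsub>W\<^esub> T v \<in> N" if w: "w \<in> carrier W" for w
  proof (cases "w = \<zero>\<^bsub>W\<^esub>")
    case True
    then show ?thesis
      using ND(2) ND(4)[OF ND(2)]
      by (intro bexI[of _ "\<zero>\<^bsub>V\<^esub>"]) (auto simp: T_zero a_minus_def)
  next
    case False
    then have pos: "0 < nrm W w"
      using w W.nrm_eq_0[of w] W.nrm_nonneg[of w] by simp
    define P where "P k p \<longleftrightarrow> fst p \<in> carrier V \<and> snd p \<in> N \<and>
        nrm W (w \<ominus>\<^bsub>W\<^esub> (T (fst p) \<oplus>\<^bsub>W\<^esub> snd p)) \<le> nrm W w * (1 / 2) ^ k" for k :: nat and p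
    have step: "\<exists>q. P (Suc k) q \<and> nrm V (fst q \<ominus>\<^bsub>V\<^esub> fst p) \<le> (C * nrm W w) * (1 / 2) ^ k"
      if "P k p" for k p
    proof -
      obtain s n where p: "p = (s, n)" by (cases p)
      have s: "s \<in> carrier V" and n: "n \<in> N"
        and u: "nrm W (w \<ominus>\<^bsub>W\<^esub> (T s \<oplus>\<^bsub>W\<^esub> n)) \<le> nrm W w * (1 / 2) ^ k"
        using that by (auto simp: P_def p)
      define u where "u = w \<ominus>\<^bsub>W\<^esub> (T s \<oplus>\<^bsub>W\<^esub> n)"
      have uW: "u \<in> carrier W" using s n w N_carrier by (simp add: u_def)
      obtain v n' where v: "v \<in> carrier V" and n': "n' \<in> N" and vC: "nrm V v \<le> C * nrm W u"
        and close: "nrm W (u \<ominus>\<^bsub>W\<^esub> (T v \<oplus>\<^bsub>W\<^esub> n')) < nrm W w * (1 / 2) ^ Suc k"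
        using approx[OF uW, of "nrm W w * (1 / 2) ^ Suc k"] pos by auto
      have "w \<ominus>\<^bsub>W\<^esub> (T (s \<oplus>\<^bsub>V\<^esub> v) \<oplus>\<^bsub>W\<^esub> (n \<oplus>\<^bsub>W\<^esub> n')) = u \<ominus>\<^bsub>W\<^esub> (T v \<oplus>\<^bsub>W\<^esub> n')"
      proof -
        have "T s \<in> carrier W" "T v \<in> carrier W" "n \<in> carrier W" "n' \<in> carrier W"
          using s v n n' N_carrier by auto
        then show ?thesis using w unfolding u_def T_add[OF s v] by algebra
      qed
      moreover have "(s \<oplus>\<^bsub>V\<^esub> v) \<ominus>\<^bsub>V\<^esub> s = v" using s v by algebra
      moreover have "C * nrm W u \<le> (C * nrm W w) * (1 / 2) ^ k"
        using u C unfolding u_def[symmetric] by simp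
      ultimately show ?thesis
        using close vC s v ND(3)[OF n n']
        by (intro exI[of _ "(s \<oplus>\<^bsub>V\<^esub> v, n \<oplus>\<^bsub>W\<^esub> n')"]) (auto simp: P_def p)
    qed
    \<comment> \<open>The clause for \<open>k = 0\<close> starts the partial sums at the zero
      vector, so that the bound on the distance from \<open>s 0\<close> becomes a bound on the norm
      of the limit.\<close>
    have "\<exists>f. \<forall>k. (P k (f k) \<and> (k = 0 \<longrightarrow> fst (f k) = \<zero>\<^bsub>V\<^esub>)) \<and>
        nrm V (fst (f (Suc k)) \<ominus>\<^bsub>V\<^esub> fst (f k)) \<le> (C * nrm W w) * (1 / 2) ^ k"
    proof (rule dependent_nat_choice)
      have "w \<ominus>\<^bsub>W\<^esub> (T \<zero>\<^bsub>V\<^esub> \<oplus>\<^bsub>W\<^esub> \<zero>\<^bsub>W\<^esub>) = w"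
        using w unfolding T_zero by algebra
      then show "\<exists>p. P 0 p \<and> (0 = (0::nat) \<longrightarrow> fst p = \<zero>\<^bsub>V\<^esub>)"
        using ND(2) by (intro exI[of _ "(\<zero>\<^bsub>V\<^esub>, \<zero>\<^bsub>W\<^esub>)"]) (simp add: P_def)
    qed (use step in auto)
    then obtain f where f: "\<And>k. P k (f k)" "fst (f 0) = \<zero>\<^bsub>V\<^esub>"
      "\<And>k. nrm V (fst (f (Suc k)) \<ominus>\<^bsub>V\<^esub> fst (f k)) \<le> (C * nrm W w) * (1 / 2) ^ k"
      by blast
    define s n where "s k = fst (f k)" and "n k = snd (f k)" for k
    have s: "s k \<in> carrier V" and n: "n k \<in> N" and nW: "n k \<in> carrier W"
      and res: "nrm W (w \<ominus>\<^bsub>W\<^esub> (T (s k) \<oplus>\<^bsub>W\<^esub> n k)) \<le> nrm W w * (1 / 2) ^ k" for k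
      using f(1)[of k] N_carrier by (auto simp: P_def s_def n_def)
    obtain v where v: "v \<in> carrier V" and lim: "(\<lambda>k. nrm V (s k \<ominus>\<^bsub>V\<^esub> v)) \<longlonglongrightarrow> 0"
      and bound: "nrm V (v \<ominus>\<^bsub>V\<^esub> s 0) \<le> 2 * (C * nrm W w)"
      using V.geometric_limit[of s "C * nrm W w"] f(3) s unfolding s_def by blast
    have "w \<ominus>\<^bsub>W\<^esub> T v \<in> N"
    proof (rule W.closed_subspace_limit[OF N n])
      show "w \<ominus>\<^bsub>W\<^esub> T v \<in> carrier W" using w v by simp
      \<comment> \<open>Up to sign, n_k - (w - Tv) is the residual at stage k plus T(s_k - v), and
        both tend to zero.\<close>
      have upper: "nrm W (n k \<ominus>\<^bsub>W\<^esub> (w \<ominus>\<^bsub>W\<^esub> T v)) \<le> nrm W w * (1 / 2) ^ k + D * nrm V (s k \<ominus>\<^bsub>V\<^esub> v)" for k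
      proof -
        have "n k \<ominus>\<^bsub>W\<^esub> (w \<ominus>\<^bsub>W\<^esub> T v) = \<ominus>\<^bsub>W\<^esub> ((w \<ominus>\<^bsub>W\<^esub> (T (s k) \<oplus>\<^bsub>W\<^esub> n k)) \<oplus>\<^bsub>W\<^esub> T (s k \<ominus>\<^bsub>V\<^esub> v))"
        proof -
          have "T (s k) \<in> carrier W" "T v \<in> carrier W" "n k \<in> carrier W"
            using s v nW by auto
          then show ?thesis using w unfolding T_diff[OF s v] by algebra
        qed
        then have "nrm W (n k \<ominus>\<^bsub>W\<^esub> (w \<ominus>\<^bsub>W\<^esub> T v))
            = nrm W ((w \<ominus>\<^bsub>W\<^esub> (T (s k) \<oplus>\<^bsub>W\<^esub> n k)) \<oplus>\<^bsub>W\<^esub> T (s k \<ominus>\<^bsub>V\<^esub> v))"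
          using s v w nW by simp
        also have "\<dots> \<le> nrm W (w \<ominus>\<^bsub>W\<^esub> (T (s k) \<oplus>\<^bsub>W\<^esub> n k)) + nrm W (T (s k \<ominus>\<^bsub>V\<^esub> v))"
          using s v w nW by (intro W.nrm_triangle) auto
        finally show ?thesis using res[of k] D(2)[of "s k \<ominus>\<^bsub>V\<^esub> v"] s v by simp
      qed
      have lower: "0 \<le> nrm W (n k \<ominus>\<^bsub>W\<^esub> (w \<ominus>\<^bsub>W\<^esub> T v))" for k
        using nW w v by (intro W.nrm_nonneg) auto
      have lim': "(\<lambda>k. nrm W w * (1 / 2) ^ k + D * nrm V (s k \<ominus>\<^bsub>V\<^esub> v)) \<longlonglongrightarrow> 0"
        by (intro tendsto_add_zero tendsto_mult_right_zero lim LIMSEQ_realpow_zero) auto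
      show "(\<lambda>k. nrm W (n k \<ominus>\<^bsub>W\<^esub> (w \<ominus>\<^bsub>W\<^esub> T v))) \<longlonglongrightarrow> 0"
        by (rule real_tendsto_sandwich[OF always_eventually always_eventually tendsto_const lim'])
          (use lower upper in blast)+
    qed
    moreover have "v \<ominus>\<^bsub>V\<^esub> s 0 = v"
      using v f(2) by (simp add: s_def a_minus_def)
    ultimately show ?thesis using v bound by (intro bexI[of _ v]) auto
  qed
  then show thesis using that[of "2 * C"] C by auto
qed

end

section \<open>Minimal idempotents and \<open>\<phi>\<close>-injectivity\<close>

lemma bounded_linear_mapsI:
  assumes "T \<in> extensional (carrier V)"
    and "\<And>x. x \<in> carrier V \<Longrightarrow> T x \<in> carrier W"
    and "\<And>x y. \<lbrakk>x \<in> carrier V; y \<in> carrier V\<rbrakk> \<Longrightarrow> T (x \<oplus>\<^bsub>V\<^esub> y) = T x \<oplus>\<^bsub>W\<^esub> T y"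
    and "\<And>c x. x \<in> carrier V \<Longrightarrow> T (c \<odot>\<^bsub>V\<^esub> x) = c \<odot>\<^bsub>W\<^esub> T x"
    and "\<And>x. x \<in> carrier V \<Longrightarrow> nrm W (T x) \<le> C * nrm V x"
  shows "T \<in> bounded_linear_maps V W"
  using assms unfolding bounded_linear_maps_def PiE_def by blast

text \<open>For given w, the v with w - Tv in \<open>N\<close> is unique: two candidates differ by a
  vector whose image lies both in the image of \<open>T\<close> and in \<open>N\<close>, hence is
  zero, and \<open>T\<close> is injective. Thus an arbitrary choice of a bounded solution is
  automatically linear and inverts \<open>T\<close>; each identity is checked by exhibiting a
  solution.\<close>

lemma admissible_left_inverse:
  assumes "banach_vs V" "banach_vs W" "admissible V W T" and inj: "inj_on T (carrier V)"
  obtains P where "P \<in> bounded_linear_maps W V" "\<And>x. x \<in> carrier V \<Longrightarrow> P (T x) = x"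
proof -
  obtain N where T: "T \<in> bounded_linear_maps V W" and N: "closed_subspace W N"
    and int: "T ` carrier V \<inter> N = {\<zero>\<^bsub>W\<^esub>}" and sum: "T ` carrier V <+>\<^bsub>W\<^esub> N = carrier W"
    using assms(3) by (auto simp: admissible_def complemented_def)
  interpret complemented_sum V W T N
    by (intro complemented_sum.intro complemented_sum_axioms.intro assms(1,2) T N sum)
  obtain C where C: "\<And>w. w \<in> carrier W \<Longrightarrow>
      \<exists>v\<in>carrier V. nrm V v \<le> C * nrm W w \<and> w \<ominus>\<^bsub>W\<^esub> T v \<in> N"
    using bounded_decomposition by blast
  define P where "P = (\<lambda>w\<in>carrier W. SOME v. v \<in> carrier V \<and>
    nrm V v \<le> C * nrm W w \<and> w \<ominus>\<^bsub>W\<^esub> T v \<in> N)"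
  have P: "P w \<in> carrier V \<and> nrm V (P w) \<le> C * nrm W w \<and> w \<ominus>\<^bsub>W\<^esub> T (P w) \<in> N"
    if "w \<in> carrier W" for w
    using someI_ex[of "\<lambda>v. v \<in> carrier V \<and> nrm V v \<le> C * nrm W w \<and> w \<ominus>\<^bsub>W\<^esub> T v \<in> N"]
      C[OF that] that unfolding P_def by auto
  have P_eqI: "P w = v" if w: "w \<in> carrier W" and v: "v \<in> carrier V" "w \<ominus>\<^bsub>W\<^esub> T v \<in> N" for w v
  proof -
    have Pw: "P w \<in> carrier V" using P[OF w] by blast
    have "T (P w) \<ominus>\<^bsub>W\<^esub> T v = (w \<ominus>\<^bsub>W\<^esub> T v) \<ominus>\<^bsub>W\<^esub> (w \<ominus>\<^bsub>W\<^esub> T (P w))"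
      using T_closed[OF Pw] T_closed[OF v(1)] w by algebra
    then have "T (P w \<ominus>\<^bsub>V\<^esub> v) \<in> N"
      using ND(5)[OF v(2)] P[OF w] by (simp add: T_diff Pw v(1))
    then have "T (P w \<ominus>\<^bsub>V\<^esub> v) = \<zero>\<^bsub>W\<^esub>"
      using int Pw v(1) by blast
    then show ?thesis
      using inj Pw v(1) T_diff[OF Pw v(1)]
      by (simp add: W.diff_eq_zero_iff inj_on_eq_iff)
  qed
  have "P \<in> bounded_linear_maps W V"
  proof (rule bounded_linear_mapsI)
    fix x y assume x: "x \<in> carrier W" and y: "y \<in> carrier W"
    have PxPy: "P x \<in> carrier V" "P y \<in> carrier V" using P x y by auto
    have "(x \<oplus>\<^bsub>W\<^esub> y) \<ominus>\<^bsub>W\<^esub> (T (P x) \<oplus>\<^bsub>W\<^esub> T (P y)) = (x \<ominus>\<^bsub>W\<^esub> T (P x)) \<oplus>\<^bsub>W\<^esub> (y \<ominus>\<^bsub>W\<^esub> T (P y))"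
      using x y T_closed[OF PxPy(1)] T_closed[OF PxPy(2)] by algebra
    then show "P (x \<oplus>\<^bsub>W\<^esub> y) = P x \<oplus>\<^bsub>V\<^esub> P y"
      using x y PxPy P ND(3) by (intro P_eqI) (auto simp: T_add)
  next
    fix c x assume x: "x \<in> carrier W"
    have Px: "P x \<in> carrier V" using P x by auto
    have "c \<odot>\<^bsub>W\<^esub> x \<ominus>\<^bsub>W\<^esub> T (c \<odot>\<^bsub>V\<^esub> P x) = c \<odot>\<^bsub>W\<^esub> (x \<ominus>\<^bsub>W\<^esub> T (P x))"
      using x Px by (simp add: T_scale W.scale_diff_right)
    then show "P (c \<odot>\<^bsub>W\<^esub> x) = c \<odot>\<^bsub>V\<^esub> P x"
      using x Px P ND(6) by (intro P_eqI) auto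
  qed (use P in \<open>auto simp: P_def\<close>)
  moreover have "P (T x) = x" if "x \<in> carrier V" for x
    using that ND(2) W.diff_eq_zero_iff[of "T x" "T x"] by (intro P_eqI) auto
  ultimately show thesis using that by blast
qed

section \<open>Constructions with bounded linear maps\<close>

lemma bounded_linear_maps_compose:
  assumes V: "normed_vs V" and W: "normed_vs W"
    and T: "T \<in> bounded_linear_maps V W" and U: "U \<in> bounded_linear_maps W X"
  shows "compose (carrier V) U T \<in> bounded_linear_maps V X"
proof -
  interpret V: normed_vs V by fact
  obtain C where C: "0 < C" "\<And>x. x \<in> carrier V \<Longrightarrow> nrm W (T x) \<le> C * nrm V x"
    using bounded_linear_maps_bound[OF V T] by blast
  obtain D where D: "0 < D" "\<And>x. x \<in> carrier W \<Longrightarrow> nrm X (U x) \<le> D * nrm W x"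
    using bounded_linear_maps_bound[OF W U] by blast
  note T = bounded_linear_mapsD[OF T] and U = bounded_linear_mapsD[OF U]
  show ?thesis
  proof (rule bounded_linear_mapsI)
    fix x assume x: "x \<in> carrier V"
    have "nrm X (U (T x)) \<le> D * nrm W (T x)"
      using D(2) T(1) x by simp
    also have "\<dots> \<le> D * (C * nrm V x)"
      using C(2)[OF x] D(1) by simp
    finally show "nrm X (compose (carrier V) U T x) \<le> (D * C) * nrm V x"
      using x by (simp add: compose_eq mult.assoc)
  qed (use T U in \<open>auto simp: compose_eq\<close>)
qed

lemma bounded_linear_maps_add:
  assumes V: "normed_vs V" and W: "normed_vs W"
    and T: "T \<in> bounded_linear_maps V W" and U: "U \<in> bounded_linear_maps V W"
  shows "(\<lambda>x\<in>carrier V. T x \<oplus>\<^bsub>W\<^esub> U x) \<in> bounded_linear_maps V W"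
proof -
  interpret V: normed_vs V by fact
  interpret W: normed_vs W by fact
  obtain C where C: "\<And>x. x \<in> carrier V \<Longrightarrow> nrm W (T x) \<le> C * nrm V x"
    using bounded_linear_maps_bound[OF V T] by blast
  obtain D where D: "\<And>x. x \<in> carrier V \<Longrightarrow> nrm W (U x) \<le> D * nrm V x"
    using bounded_linear_maps_bound[OF V U] by blast
  note T = bounded_linear_mapsD[OF T] and U = bounded_linear_mapsD[OF U]
  show ?thesis
  proof (rule bounded_linear_mapsI)
    fix x y assume "x \<in> carrier V" "y \<in> carrier V"
    then show "(\<lambda>x\<in>carrier V. T x \<oplus>\<^bsub>W\<^esub> U x) (x \<oplus>\<^bsub>V\<^esub> y) =
        (\<lambda>x\<in>carrier V. T x \<oplus>\<^bsub>W\<^esub> U x) x \<oplus>\<^bsub>W\<^esub> (\<lambda>x\<in>carrier V. T x \<oplus>\<^bsub>W\<^esub> U x) y"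
      using T(1,2) U(1,2) by (simp add: W.M.a_ac)
  next
    fix x assume x: "x \<in> carrier V"
    then show "nrm W ((\<lambda>x\<in>carrier V. T x \<oplus>\<^bsub>W\<^esub> U x) x) \<le> (C + D) * nrm V x"
      using W.nrm_triangle[OF T(1) U(1), of x x] C[OF x] D[OF x] by (simp add: distrib_right)
  qed (use T U in \<open>auto simp: W.scale_add_right\<close>)
qed

lemma (in normed_vs) bounded_linear_maps_id_minus:
  assumes T: "T \<in> bounded_linear_maps V V"
  shows "(\<lambda>x\<in>carrier V. x \<ominus> T x) \<in> bounded_linear_maps V V"
proof -
  obtain C where C: "\<And>x. x \<in> carrier V \<Longrightarrow> nrm V (T x) \<le> C * nrm V x"
    using bounded_linear_maps_bound[OF normed_vs_axioms T] by blast
  note T = bounded_linear_mapsD[OF T]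
  show ?thesis
  proof (rule bounded_linear_mapsI)
    fix x y assume x: "x \<in> carrier V" and y: "y \<in> carrier V"
    have "(x \<oplus> y) \<ominus> (T x \<oplus> T y) = (x \<ominus> T x) \<oplus> (y \<ominus> T y)"
      using x y T(1)[OF x] T(1)[OF y] by algebra
    then show "(\<lambda>x\<in>carrier V. x \<ominus> T x) (x \<oplus> y) =
        (\<lambda>x\<in>carrier V. x \<ominus> T x) x \<oplus> (\<lambda>x\<in>carrier V. x \<ominus> T x) y"
      using x y by (simp add: T(2))
  next
    fix x assume x: "x \<in> carrier V"
    then show "nrm V ((\<lambda>x\<in>carrier V. x \<ominus> T x) x) \<le> (1 + C) * nrm V x"
      using nrm_diff_le[OF x T(1)[OF x]] C[OF x] by (simp add: distrib_right)
  qed (use T in \<open>auto simp: scale_diff_right\<close>)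
qed

lemma (in banach_left_module) bounded_linear_maps_act:
  assumes a: "a \<in> carrier A"
  shows "(\<lambda>x\<in>carrier E. act E a x) \<in> bounded_linear_maps E E"
proof -
  obtain C where C: "\<And>b x. \<lbrakk>b \<in> carrier A; x \<in> carrier E\<rbrakk> \<Longrightarrow> nrm E (act E b x) \<le> C * nrm A b * nrm E x"
    using act_bounded by blast
  show ?thesis
    by (rule bounded_linear_mapsI[where C = "C * nrm A a"])
      (use C a act_closed act_add_right act_smult_right in auto)
qed

lemma (in banach_left_module) act_diff_right:
  assumes "a \<in> carrier A" "x \<in> carrier E" "y \<in> carrier E"
  shows "act E a (x \<ominus>\<^bsub>E\<^esub> y) = act E a x \<ominus>\<^bsub>E\<^esub> act E a y"
  using bounded_linear_maps_diff(1)[OF E.normed_vs_axioms E.normed_vs_axioms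
      bounded_linear_maps_act[OF assms(1)] assms(2,3)] assms by simp

lemma left_module_mapsD:
  assumes "T \<in> left_module_maps A F K"
  shows "T \<in> bounded_linear_maps F K"
    and "\<And>a x. \<lbrakk>a \<in> carrier A; x \<in> carrier F\<rbrakk> \<Longrightarrow> T (act F a x) = act K a (T x)"
  using assms by (auto simp: left_module_maps_def)

text \<open>
  Since \<open>\<phi> e = 1\<close>, the element \<open>k - ek\<close> lies in \<open>I(\<phi>, K)\<close> and hence in the image of \<open>T\<close>, while
  \<open>A\<close> acts on \<open>eK\<close> through \<open>\<phi>\<close>, so that on \<open>eK\<close> every linear map into \<open>eE\<close> is a module morphism.
  Thus \<open>k \<mapsto> S (P (k - ek)) + S (e P (ek))\<close> extends \<open>S\<close>, for any bounded left inverse \<open>P\<close> of \<open>T\<close>.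
\<close>

theorem phi_injective_of_minimal_idempotent:
  fixes A :: "'a normed" and E :: "('a, 'e) normed_module"
  assumes modE: "banach_left_module A E" and \<phi>: "\<phi> \<in> characters A"
    and e: "e \<in> carrier A" "\<phi> e = 1"
    and le: "\<And>a. a \<in> carrier A \<Longrightarrow> a \<otimes>\<^bsub>A\<^esub> e = \<phi> a \<odot>\<^bsub>A\<^esub> e"
    and re: "\<And>a. a \<in> carrier A \<Longrightarrow> e \<otimes>\<^bsub>A\<^esub> a = \<phi> a \<odot>\<^bsub>A\<^esub> e"
  shows "phi_injective TYPE('f) TYPE('k) A \<phi> E"
  unfolding phi_injective_def
proof (intro conjI allI impI modE \<phi>)
  fix F :: "('a, 'f) normed_module" and K :: "('a, 'k) normed_module" and T
  assume modF: "banach_left_module A F" and modK: "banach_left_module A K"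
    and T: "T \<in> left_module_maps A F K" and inj: "inj_on T (carrier F)"
    and adm: "admissible F K T" and span: "phi_span A \<phi> K \<subseteq> T ` carrier F"
  interpret E: banach_left_module A E by fact
  interpret F: banach_left_module A F by fact
  interpret K: banach_left_module A K by fact
  note blF = F.E.normed_vs_axioms and blK = K.E.normed_vs_axioms and blE = E.E.normed_vs_axioms
  note TD = left_module_mapsD[OF T]
  note Tlin = bounded_linear_mapsD[OF TD(1)]
  show "(\<lambda>R. compose (carrier F) R T) ` left_module_maps A K E = left_module_maps A F E"
  proof (intro equalityI subsetI)
    fix S assume "S \<in> (\<lambda>R. compose (carrier F) R T) ` left_module_maps A K E"
    then obtain R where R: "R \<in> left_module_maps A K E" and S: "S = compose (carrier F) R T"
      by blast
    note RD = left_module_mapsD[OF R]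
    have "S \<in> bounded_linear_maps F E"
      unfolding S by (rule bounded_linear_maps_compose[OF blF blK TD(1) RD(1)])
    moreover have "S (act F a x) = act E a (S x)" if "a \<in> carrier A" "x \<in> carrier F" for a x
      using that by (simp add: S compose_eq F.act_closed TD(2) RD(2) Tlin(1))
    ultimately show "S \<in> left_module_maps A F E"
      by (simp add: left_module_maps_def)
  next
    fix S assume S: "S \<in> left_module_maps A F E"
    note SD = left_module_mapsD[OF S]
    note Slin = bounded_linear_mapsD[OF SD(1)]
    obtain P where P: "P \<in> bounded_linear_maps K F" and PT: "\<And>x. x \<in> carrier F \<Longrightarrow> P (T x) = x"
      using admissible_left_inverse[OF F.E.banach_vs_axioms K.E.banach_vs_axioms adm inj] by blast
    note Plin = bounded_linear_mapsD[OF P]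
    define eF where "eF = (\<lambda>x\<in>carrier F. act F e x)"
    define eK where "eK = (\<lambda>x\<in>carrier K. act K e x)"
    define dK where "dK = (\<lambda>x\<in>carrier K. x \<ominus>\<^bsub>K\<^esub> eK x)"
    have eF: "eF \<in> bounded_linear_maps F F"
      unfolding eF_def by (rule F.bounded_linear_maps_act[OF e(1)])
    have eK: "eK \<in> bounded_linear_maps K K"
      unfolding eK_def by (rule K.bounded_linear_maps_act[OF e(1)])
    have dK: "dK \<in> bounded_linear_maps K K"
      unfolding dK_def by (rule K.E.bounded_linear_maps_id_minus[OF eK])
    \<comment> \<open>\<open>P\<close> is only linear, so P(ek) need not lie in eF. Applying
      \<open>eF\<close> once more puts it there, where the algebra acts through \<phi>.\<close>
    define R where "R = (\<lambda>k\<in>carrier K.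
      compose (carrier K) S (compose (carrier K) P dK) k \<oplus>\<^bsub>E\<^esub>
      compose (carrier K) (compose (carrier F) S eF) (compose (carrier K) P eK) k)"
    have R: "R \<in> bounded_linear_maps K E"
      unfolding R_def
      by (intro bounded_linear_maps_add bounded_linear_maps_compose[OF blK blF]
          bounded_linear_maps_compose[OF blK blK] bounded_linear_maps_compose[OF blF blF]
          blK blE SD(1) P eF eK dK)
    have R_eq: "R k = S (P (k \<ominus>\<^bsub>K\<^esub> act K e k)) \<oplus>\<^bsub>E\<^esub> S (act F e (P (act K e k)))"
      if "k \<in> carrier K" for k
      using that by (simp add: R_def dK_def eK_def eF_def compose_eq Plin(1) K.act_closed e(1))
    \<comment> \<open>Stated for an arbitrary module because it is applied to both \<open>F\<close>
      and \<open>K\<close>. The first equation uses ae = \<phi>(a)e, the second ea =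
      \<phi>(a)e.\<close>
    have comm: "act X a (act X e x) = \<phi> a \<odot>\<^bsub>X\<^esub> act X e x" "act X e (act X a x) = \<phi> a \<odot>\<^bsub>X\<^esub> act X e x"
      if X: "banach_left_module A X" and a: "a \<in> carrier A" and x: "x \<in> carrier X" for a x
        and X :: "('a, 'x) normed_module"
    proof -
      interpret X: banach_left_module A X by fact
      show "act X a (act X e x) = \<phi> a \<odot>\<^bsub>X\<^esub> act X e x"
        using X.act_assoc[OF a e(1) x] X.act_smult_left[OF e(1) x] by (simp add: le a)
      show "act X e (act X a x) = \<phi> a \<odot>\<^bsub>X\<^esub> act X e x"
        using X.act_assoc[OF e(1) a x] X.act_smult_left[OF e(1) x] by (simp add: re a)
    qed
    note commF = comm[OF modF] and commK = comm[OF modK]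
    have TP: "T (P (k \<ominus>\<^bsub>K\<^esub> act K e k)) = k \<ominus>\<^bsub>K\<^esub> act K e k" if k: "k \<in> carrier K" for k
    proof -
      have "act K e k \<ominus>\<^bsub>K\<^esub> \<phi> e \<odot>\<^bsub>K\<^esub> k \<in> phi_span A \<phi> K"
        unfolding phi_span_def lin_span_def by (rule hull_inc) (use e(1) k in blast)
      then obtain x where x: "x \<in> carrier F" "act K e k \<ominus>\<^bsub>K\<^esub> k = T x"
        using span k by (auto simp: e(2))
      have "k \<ominus>\<^bsub>K\<^esub> act K e k = (- 1) \<odot>\<^bsub>K\<^esub> (act K e k \<ominus>\<^bsub>K\<^esub> k)"
        using k e(1) K.act_closed by (simp add: K.E.scale_minus_one K.E.minus_diff)
      also have "\<dots> = T ((- 1) \<odot>\<^bsub>F\<^esub> x)"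
        using x by (simp add: Tlin(3))
      finally show ?thesis using x(1) PT by simp
    qed
    have R_act: "R (act K a k) = act E a (R k)" if a: "a \<in> carrier A" and k: "k \<in> carrier K" for a k
    proof -
      have ek: "act K e k \<in> carrier K" and ak: "act K a k \<in> carrier K"
        using K.act_closed e(1) a k by auto
      define x where "x = P (k \<ominus>\<^bsub>K\<^esub> act K e k)"
      define y where "y = P (act K e k)"
      have xy: "x \<in> carrier F" "y \<in> carrier F"
        using Plin(1) k ek by (auto simp: x_def y_def)
      \<comment> \<open>Both rules for \<open>e\<close> meet here: a(ek) and e(ak) equal
        \<phi>(a)ek, so the action of \<open>a\<close> carries k - ek to the same expression formed
        from ak.\<close>
      have "act K a k \<ominus>\<^bsub>K\<^esub> act K e (act K a k) = act K a (k \<ominus>\<^bsub>K\<^esub> act K e k)"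
        using a k ek by (simp add: K.act_diff_right commK)
      also have "\<dots> = T (act F a x)"
        using TP[OF k] a xy by (simp add: TD(2) x_def)
      finally have "P (act K a k \<ominus>\<^bsub>K\<^esub> act K e (act K a k)) = act F a x"
        using PT F.act_closed a xy by simp
      \<comment> \<open>Linearity of \<open>P\<close> suffices: P(e(ak)) = \<phi>(a)P(ek), and after
        multiplication by \<open>e\<close> the scalar \<phi>(a) is again the action of
        \<open>a\<close>.\<close>
      moreover have "act F e (P (act K e (act K a k))) = act F a (act F e y)"
        using a k ek xy e(1) by (simp add: commK commF Plin(3) F.act_smult_right y_def)
      ultimately have "R (act K a k) = S (act F a x) \<oplus>\<^bsub>E\<^esub> S (act F a (act F e y))"
        using ak by (simp add: R_eq)
      also have "\<dots> = act E a (R k)"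
        using a k xy e(1) F.act_closed Slin(1) E.act_add_right E.act_closed
        by (simp add: R_eq SD(2) x_def y_def)
      finally show ?thesis .
    qed
    have "compose (carrier F) R T = S"
    proof (rule extensionalityI[OF compose_extensional Slin(4)])
      fix x assume x: "x \<in> carrier F"
      have ex: "act F e x \<in> carrier F" using F.act_closed e(1) x by blast
      have "T x \<ominus>\<^bsub>K\<^esub> act K e (T x) = T (x \<ominus>\<^bsub>F\<^esub> act F e x)"
        using bounded_linear_maps_diff(1)[OF blF blK TD(1) x ex] TD(2)[OF e(1) x] by simp
      \<comment> \<open>Since T is a morphism, e(Tx) = T(ex), which \<open>P\<close> returns to ex;
        the outer \<open>e\<close> changes nothing because ee = \<phi>(e)e = e.\<close>
      moreover have "act F e (P (act K e (T x))) = act F e x"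
        using TD(2)[OF e(1) x] PT[OF ex] commF(1)[OF e(1) x] e(2) ex by simp
      ultimately have "R (T x) = S (x \<ominus>\<^bsub>F\<^esub> act F e x) \<oplus>\<^bsub>E\<^esub> S (act F e x)"
        using x ex Tlin(1) PT by (simp add: R_eq)
      also have "\<dots> = S (x \<ominus>\<^bsub>F\<^esub> act F e x \<oplus>\<^bsub>F\<^esub> act F e x)"
        using x ex by (simp add: Slin(2))
      also have "x \<ominus>\<^bsub>F\<^esub> act F e x \<oplus>\<^bsub>F\<^esub> act F e x = x"
        using x ex by algebra
      finally show "compose (carrier F) R T x = S x"
        using x by (simp add: compose_eq)
    qed
    moreover have "R \<in> left_module_maps A K E"
      using R R_act by (simp add: left_module_maps_def)
    ultimately show "S \<in> (\<lambda>R. compose (carrier F) R T) ` left_module_maps A K E"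
      by blast
  qed
qed

section \<open>Quotient modules\<close>

text \<open>Allows the two records to have different extension fields: \<open>regular_module\<close>
  repackages an algebra together with the field \<open>act\<close>, and the normed structure has to
  be carried over.\<close>

lemma normed_vs_cong:
  fixes V :: "('v, 'x) normed_scheme" and W :: "('v, 'y) normed_scheme"
  assumes V: "normed_vs V"
    and eq: "carrier W = carrier V" "add W = add V" "zero W = zero V" "smult W = smult V" "nrm W = nrm V"
  shows "normed_vs W"
proof -
  interpret V: normed_vs V by fact
  have "abelian_group W"
    by (rule abelian_groupI) (auto simp: eq V.M.a_ac intro: V.M.l_neg)
  then have "module complex_ring W"
    using V.smult_l_distr V.smult_r_distr V.smult_assoc1
    by (intro moduleI module.axioms(1)[OF V.module_axioms]) (auto simp: eq)
  moreover have "normed_vs_axioms W"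
    using V.nrm_nonneg V.nrm_eq_0 V.nrm_triangle V.nrm_smult by unfold_locales (auto simp: eq)
  ultimately show ?thesis by (rule normed_vs.intro)
qed

lemma ndist_cong:
  fixes V :: "('v, 'x) normed_scheme" and W :: "('v, 'y) normed_scheme"
  assumes "carrier W = carrier V" "add W = add V" "zero W = zero V" "nrm W = nrm V"
  shows "ndist W = ndist V"
  by (simp add: fun_eq_iff ndist_def a_minus_def a_inv_def m_inv_def assms)

lemma banach_vs_cong:
  fixes V :: "('v, 'x) normed_scheme" and W :: "('v, 'y) normed_scheme"
  assumes "banach_vs V"
    and "carrier W = carrier V" "add W = add V" "zero W = zero V" "smult W = smult V" "nrm W = nrm V"
  shows "banach_vs W"
  using assms normed_vs_cong[of V W] ndist_cong[of W V]
  by (simp add: banach_vs_def banach_vs_axioms_def)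

lemma regular_module_simps [simp]:
  "carrier (regular_module A) = carrier A" "add (regular_module A) = add A"
  "zero (regular_module A) = zero A" "smult (regular_module A) = smult A"
  "nrm (regular_module A) = nrm A" "act (regular_module A) = mult A"
  by (simp_all add: regular_module_def)

lemma banach_left_module_regular:
  assumes "banach_algebra A"
  shows "banach_left_module A (regular_module A)"
proof -
  interpret A: banach_algebra A by fact
  interpret E: banach_vs "regular_module A"
    by (rule banach_vs_cong[OF A.banach_vs_axioms]) auto
  show ?thesis
    using A.mult_closed A.mult_assoc A.mult_add_left A.mult_add_right A.mult_smult_left
      A.mult_smult_right A.nrm_mult
    by unfold_locales (auto intro!: exI[of _ 1])
qed

lemma closed_subspace_regular:
  assumes "normed_vs A" "closed_subspace A N"
  shows "closed_subspace (regular_module A) N"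
proof -
  interpret A: normed_vs A by fact
  have "ndist (regular_module A) = ndist A"
    by (rule ndist_cong) auto
  moreover have "lin_subspace (regular_module A) N"
    using A.lin_subspaceD[of N] assms(2)
    by (intro normed_vs.lin_subspaceI[OF normed_vs_cong[OF assms(1)]]) (auto simp: closed_subspace_def)
  ultimately show ?thesis
    using assms(2) by (simp add: closed_subspace_def)
qed

locale closed_submodule = banach_left_module A E
  for A :: "('a, 'x) normed_scheme" and E :: "('a, 'v) normed_module" +
  fixes N
  assumes closed: "closed_subspace E N"
    and act_mem: "\<lbrakk>a \<in> carrier A; n \<in> N\<rbrakk> \<Longrightarrow> act E a n \<in> N"
begin

abbreviation Q where "Q \<equiv> quotient_module E N"

abbreviation q where "q x \<equiv> N +>\<^bsub>E\<^esub> x"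

lemma subspace: "lin_subspace E N"
  using closed by (simp add: closed_subspace_def)

lemmas ND = E.lin_subspaceD[OF subspace]

sublocale N: abelian_subgroup N E
  using subspace E.M.abelian_group_axioms
  by (intro abelian_subgroupI3 additive_subgroupI) (auto simp: submodule_def)

lemma carrier_Q: "carrier Q = q ` carrier E"
  by (auto simp: quotient_module_def A_RCOSETS_def')

lemma q_eq_iff:
  assumes "x \<in> carrier E" "y \<in> carrier E"
  shows "q x = q y \<longleftrightarrow> x \<ominus>\<^bsub>E\<^esub> y \<in> N"
proof
  assume "q x = q y"
  then have "x \<in> q y"
    using N.a_rcos_self[OF assms(1)] by simp
  then obtain n where n: "n \<in> N" "x = n \<oplus>\<^bsub>E\<^esub> y" by (auto simp: a_r_coset_def')
  then have "n \<in> carrier E" using ND(1) by blast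
  then have "x \<ominus>\<^bsub>E\<^esub> y = n" using assms(2) unfolding n(2) by algebra
  then show "x \<ominus>\<^bsub>E\<^esub> y \<in> N" using n(1) by simp
next
  assume *: "x \<ominus>\<^bsub>E\<^esub> y \<in> N"
  have "(x \<ominus>\<^bsub>E\<^esub> y) \<oplus>\<^bsub>E\<^esub> y = x" using assms by algebra
  then have "x \<in> q y" using E.M.a_rcosI[OF * ND(1) assms(2)] by simp
  then show "q x = q y"
    using E.M.a_repr_independence[OF _ assms(2) N.a_subgroup] by simp
qed

lemma mem_q_iff:
  assumes "x \<in> carrier E"
  shows "y \<in> q x \<longleftrightarrow> y \<in> carrier E \<and> q y = q x"
proof
  assume y: "y \<in> q x"
  then have "y \<in> carrier E"
    using E.M.a_r_coset_subset_G[OF ND(1) assms] by blast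
  then show "y \<in> carrier E \<and> q y = q x"
    using E.M.a_repr_independence[OF y assms N.a_subgroup] by simp
next
  assume "y \<in> carrier E \<and> q y = q x"
  then show "y \<in> q x" using N.a_rcos_self[of y] by simp
qed

lemma q_add: "\<lbrakk>x \<in> carrier E; y \<in> carrier E\<rbrakk> \<Longrightarrow> q x \<oplus>\<^bsub>Q\<^esub> q y = q (x \<oplus>\<^bsub>E\<^esub> y)"
  by (simp add: quotient_module_def N.a_rcos_sum)

text \<open>The operations of \<open>quotient_module\<close> are unions over all representatives of
  a coset. Once the resulting coset is independent of the representative, the union collapses to
  it.\<close>

lemma UN_q_const:
  assumes x: "x \<in> carrier E"
    and f: "\<And>y. \<lbrakk>y \<in> carrier E; q y = q x\<rbrakk> \<Longrightarrow> q (f y) = q (f x)"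
  shows "(\<Union>y\<in>q x. q (f y)) = q (f x)"
proof -
  have "(\<Union>y\<in>q x. q (f y)) = (\<Union>y\<in>q x. q (f x))"
    by (rule SUP_cong[OF refl], rule f) (use x mem_q_iff in blast)+
  moreover have "x \<in> q x" using x mem_q_iff by blast
  ultimately show ?thesis by auto
qed

lemma q_scale:
  assumes x: "x \<in> carrier E"
  shows "c \<odot>\<^bsub>Q\<^esub> q x = q (c \<odot>\<^bsub>E\<^esub> x)"
proof -
  have "q (c \<odot>\<^bsub>E\<^esub> y) = q (c \<odot>\<^bsub>E\<^esub> x)" if "y \<in> carrier E" "q y = q x" for y
    using that x ND(6)[of "y \<ominus>\<^bsub>E\<^esub> x" c] by (simp add: q_eq_iff E.scale_diff_right)
  then show ?thesis using UN_q_const[OF x] by (simp add: quotient_module_def)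
qed

lemma q_act:
  assumes a: "a \<in> carrier A" and x: "x \<in> carrier E"
  shows "act Q a (q x) = q (act E a x)"
proof -
  have "q (act E a y) = q (act E a x)" if "y \<in> carrier E" "q y = q x" for y
    using that x a act_mem[of a "y \<ominus>\<^bsub>E\<^esub> x"] by (simp add: q_eq_iff act_diff_right act_closed)
  then show ?thesis using UN_q_const[OF x] by (simp add: quotient_module_def)
qed

lemma q_zero: "\<zero>\<^bsub>Q\<^esub> = q \<zero>\<^bsub>E\<^esub>"
  using ND(1) by (simp add: quotient_module_def)

lemma abelian_group_Q: "abelian_group Q"
proof (rule abelian_groupI)
  fix X Y Z assume "X \<in> carrier Q" "Y \<in> carrier Q" "Z \<in> carrier Q"
  then obtain x y z where "x \<in> carrier E" "X = q x" "y \<in> carrier E" "Y = q y"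
    "z \<in> carrier E" "Z = q z"
    by (auto simp: carrier_Q)
  then show "X \<oplus>\<^bsub>Q\<^esub> Y \<in> carrier Q" "X \<oplus>\<^bsub>Q\<^esub> Y \<oplus>\<^bsub>Q\<^esub> Z = X \<oplus>\<^bsub>Q\<^esub> (Y \<oplus>\<^bsub>Q\<^esub> Z)"
    "X \<oplus>\<^bsub>Q\<^esub> Y = Y \<oplus>\<^bsub>Q\<^esub> X" "\<zero>\<^bsub>Q\<^esub> \<oplus>\<^bsub>Q\<^esub> X = X"
    by (simp_all add: carrier_Q q_add q_zero E.M.a_ac)
next
  show "\<exists>Y\<in>carrier Q. Y \<oplus>\<^bsub>Q\<^esub> X = \<zero>\<^bsub>Q\<^esub>" if X: "X \<in> carrier Q" for X
  proof -
    obtain x where x: "x \<in> carrier E" "X = q x" using X by (auto simp: carrier_Q)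
    then have "q (\<ominus>\<^bsub>E\<^esub> x) \<in> carrier Q" "q (\<ominus>\<^bsub>E\<^esub> x) \<oplus>\<^bsub>Q\<^esub> X = \<zero>\<^bsub>Q\<^esub>"
      by (auto simp: carrier_Q q_add q_zero E.M.l_neg)
    then show ?thesis by blast
  qed
qed (auto simp: carrier_Q q_zero)

lemma module_Q: "module complex_ring Q"
proof (rule moduleI)
  show "cring complex_ring" by (rule module.axioms(1)[OF E.module_axioms])
  show "abelian_group Q" by (rule abelian_group_Q)
qed (auto simp: carrier_Q q_add q_scale complex_ring_def E.scale_add_left E.scale_add_right
    E.scale_scale)

lemma nrm_q_le:
  assumes "x \<in> carrier E"
  shows "nrm Q (q x) \<le> nrm E x"
  using assms unfolding quotient_module_def
  by (auto intro!: cINF_lower bdd_belowI2[where m = 0] simp: mem_q_iff E.nrm_nonneg)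

lemma nrm_q_approx:
  assumes x: "x \<in> carrier E" and \<epsilon>: "0 < \<epsilon>"
  obtains y where "y \<in> carrier E" "q y = q x" "nrm E y < nrm Q (q x) + \<epsilon>"
proof -
  have "(INF y\<in>q x. nrm E y) < nrm Q (q x) + \<epsilon>"
    using \<epsilon> by (simp add: quotient_module_def)
  moreover have "q x \<noteq> {}" using x mem_q_iff[OF x, of x] by auto
  moreover have "bdd_below (nrm E ` q x)"
    using x by (intro bdd_belowI2[where m = 0]) (simp add: mem_q_iff E.nrm_nonneg)
  ultimately obtain y where "y \<in> q x" "nrm E y < nrm Q (q x) + \<epsilon>"
    by (auto simp: cINF_less_iff)
  then show thesis using that x by (auto simp: mem_q_iff)
qed

text \<open>The way to use that the quotient norm is an infimum: an estimate valid for every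
  representative passes to the coset.\<close>

lemma nrm_q_leI:
  assumes x: "x \<in> carrier E"
    and le: "\<And>y. \<lbrakk>y \<in> carrier E; q y = q x\<rbrakk> \<Longrightarrow> b \<le> C * nrm E y" and C: "0 \<le> C"
  shows "b \<le> C * nrm Q (q x)"
proof (rule field_le_epsilon)
  fix \<epsilon> :: real assume \<epsilon>: "0 < \<epsilon>"
  \<comment> \<open>The slack \<epsilon> / (C + 1) is positive also for C = 0 and costs at most
    \<epsilon> after multiplication by C.\<close>
  then obtain y where y: "y \<in> carrier E" "q y = q x" "nrm E y < nrm Q (q x) + \<epsilon> / (C + 1)"
    using nrm_q_approx[OF x, of "\<epsilon> / (C + 1)"] C by auto
  have "b \<le> C * (nrm Q (q x) + \<epsilon> / (C + 1))"
    using le[OF y(1,2)] y(3) C by (meson mult_left_mono less_imp_le order_trans)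
  also have "\<dots> = C * nrm Q (q x) + \<epsilon> * (C / (C + 1))"
    by (simp add: algebra_simps)
  also have "\<dots> \<le> C * nrm Q (q x) + \<epsilon>"
    using \<epsilon> C by (intro add_left_mono mult_left_le) auto
  finally show "b \<le> C * nrm Q (q x) + \<epsilon>" .
qed

lemma normed_vs_Q: "normed_vs Q"
proof (intro normed_vs.intro module_Q normed_vs_axioms.intro)
  have nonneg: "0 \<le> nrm Q (q x)" if "x \<in> carrier E" for x
    using nrm_q_leI[OF that, of 0 1] E.nrm_nonneg by simp
  then show "0 \<le> nrm Q X" if "X \<in> carrier Q" for X
    using that by (auto simp: carrier_Q)
  show "nrm Q X = 0 \<longleftrightarrow> X = \<zero>\<^bsub>Q\<^esub>" if "X \<in> carrier Q" for X
  proof -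
    obtain x where x: "x \<in> carrier E" "X = q x" using \<open>X \<in> carrier Q\<close> by (auto simp: carrier_Q)
    show ?thesis
    proof
      assume 0: "nrm Q X = 0"
      \<comment> \<open>Representatives y_k of the coset tend to zero, so the elements x - y_k of
        \<open>N\<close> tend to x, and closedness of \<open>N\<close> puts x into
        \<open>N\<close>.\<close>
      have "\<exists>y. y \<in> carrier E \<and> q y = q x \<and> nrm E y < inverse (real (Suc k))" for k
        using nrm_q_approx[OF x(1), of "inverse (real (Suc k))"] 0 x(2) by (auto simp: field_simps)
      then obtain y where y: "\<And>k. y k \<in> carrier E" "\<And>k. q (y k) = q x"
        "\<And>k. nrm E (y k) < inverse (real (Suc k))"
        by metis
      have "x \<in> N"
      proof (rule E.closed_subspace_limit[OF closed _ x(1)])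
        show "x \<ominus>\<^bsub>E\<^esub> y k \<in> N" for k
          using y(1,2)[of k] x(1) q_eq_iff by metis
        have "x \<ominus>\<^bsub>E\<^esub> y k \<ominus>\<^bsub>E\<^esub> x = \<ominus>\<^bsub>E\<^esub> y k" for k
          using x(1) y(1)[of k] by algebra
        then have eq: "nrm E (x \<ominus>\<^bsub>E\<^esub> y k \<ominus>\<^bsub>E\<^esub> x) = nrm E (y k)" for k
          by (simp add: y(1))
        show "(\<lambda>k. nrm E (x \<ominus>\<^bsub>E\<^esub> y k \<ominus>\<^bsub>E\<^esub> x)) \<longlonglongrightarrow> 0"
          unfolding eq
          by (rule real_tendsto_sandwich[OF always_eventually always_eventually tendsto_const
                LIMSEQ_inverse_real_of_nat])
            (use y E.nrm_nonneg less_imp_le in blast)+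
      qed
      then show "X = \<zero>\<^bsub>Q\<^esub>"
        using x by (simp add: q_zero q_eq_iff a_minus_def E.M.a_inv_zero)
    next
      assume "X = \<zero>\<^bsub>Q\<^esub>"
      then show "nrm Q X = 0"
        using nrm_q_le[of "\<zero>\<^bsub>E\<^esub>"] nonneg[of "\<zero>\<^bsub>E\<^esub>"] by (simp add: q_zero)
    qed
  qed
  show "nrm Q (X \<oplus>\<^bsub>Q\<^esub> Y) \<le> nrm Q X + nrm Q Y" if "X \<in> carrier Q" "Y \<in> carrier Q" for X Y
  proof -
    obtain x y where x: "x \<in> carrier E" "X = q x" and y: "y \<in> carrier E" "Y = q y"
      using \<open>X \<in> carrier Q\<close> \<open>Y \<in> carrier Q\<close> by (auto simp: carrier_Q)
    \<comment> \<open>The infimum is taken in one argument at a time: here the representative of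
      \<open>x\<close> is fixed and that of \<open>y\<close> varies; afterwards the roles
      change.\<close>
    have "nrm Q (q (x \<oplus>\<^bsub>E\<^esub> y)) - nrm E x' \<le> 1 * nrm Q (q y)"
      if x': "x' \<in> carrier E" "q x' = q x" for x'
    proof (rule nrm_q_leI[OF y(1)])
      fix y' assume y': "y' \<in> carrier E" "q y' = q y"
      have "q (x \<oplus>\<^bsub>E\<^esub> y) = q (x' \<oplus>\<^bsub>E\<^esub> y')"
        using x' y' x y by (metis q_add)
      then show "nrm Q (q (x \<oplus>\<^bsub>E\<^esub> y)) - nrm E x' \<le> 1 * nrm E y'"
        using nrm_q_le[of "x' \<oplus>\<^bsub>E\<^esub> y'"] E.nrm_triangle[OF x'(1) y'(1)] x' y' by simp
    qed simp
    then have "nrm Q (q (x \<oplus>\<^bsub>E\<^esub> y)) - nrm Q (q y) \<le> 1 * nrm Q (q x)"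
      by (intro nrm_q_leI[OF x(1)]) fastforce+
    then show ?thesis using x y by (simp add: q_add)
  qed
  show "nrm Q (c \<odot>\<^bsub>Q\<^esub> X) = norm c * nrm Q X" if "X \<in> carrier Q" for c X
  proof -
    have le: "nrm Q (q (d \<odot>\<^bsub>E\<^esub> x)) \<le> norm d * nrm Q (q x)" if x: "x \<in> carrier E" for d x
    proof (rule nrm_q_leI[OF x])
      fix y assume y: "y \<in> carrier E" "q y = q x"
      then have "q (d \<odot>\<^bsub>E\<^esub> x) = q (d \<odot>\<^bsub>E\<^esub> y)" using x q_scale by metis
      then show "nrm Q (q (d \<odot>\<^bsub>E\<^esub> x)) \<le> norm d * nrm E y"
        using nrm_q_le[of "d \<odot>\<^bsub>E\<^esub> y"] y by (simp add: E.nrm_smult)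
    qed simp
    obtain x where x: "x \<in> carrier E" "X = q x" using \<open>X \<in> carrier Q\<close> by (auto simp: carrier_Q)
    \<comment> \<open>For c \<noteq> 0 the reverse inequality is \<open>le\<close> applied to the
      inverse scalar.\<close>
    have "norm c * nrm Q (q x) \<le> nrm Q (q (c \<odot>\<^bsub>E\<^esub> x))"
    proof (cases "c = 0")
      case True
      then show ?thesis using nonneg x by simp
    next
      case False
      then have "nrm Q (q x) \<le> norm (inverse c) * nrm Q (q (c \<odot>\<^bsub>E\<^esub> x))"
        using le[of "c \<odot>\<^bsub>E\<^esub> x" "inverse c"] x by (simp add: E.scale_scale)
      then show ?thesis
        using False by (simp add: norm_inverse pos_le_divide_eq inverse_eq_divide norm_divide mult.commute)
    qed
    then show ?thesis using le[OF x(1), of c] x by (simp add: q_scale)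
  qed
qed

sublocale Q: normed_vs Q
  by (rule normed_vs_Q)

lemma q_diff:
  assumes "x \<in> carrier E" "y \<in> carrier E"
  shows "q x \<ominus>\<^bsub>Q\<^esub> q y = q (x \<ominus>\<^bsub>E\<^esub> y)"
proof -
  have "q y \<in> carrier Q" using assms by (auto simp: carrier_Q)
  then have "\<ominus>\<^bsub>Q\<^esub> q y = q (\<ominus>\<^bsub>E\<^esub> y)"
    using assms by (metis Q.scale_minus_one E.scale_minus_one q_scale)
  then show ?thesis using assms by (simp add: a_minus_def q_add)
qed

text \<open>A subsequence with steps below 2^(-k) is lifted to \<open>E\<close> term by term with
  steps of the same size. The lifts converge, their limit projects to a limit of the subsequence,
  and a Cauchy sequence with a convergent subsequence converges.\<close>

lemma banach_vs_Q: "banach_vs Q"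
proof (intro banach_vs.intro normed_vs_Q banach_vs_axioms.intro)
  show "Q.MS.mcomplete"
    unfolding Q.MS.mcomplete_def
  proof (intro allI impI)
    fix X assume X: "Q.MS.MCauchy X"
    then have XQ: "X k \<in> carrier Q" for k
      by (auto simp: Q.MS.MCauchy_def)
    have "\<exists>N. \<forall>m\<ge>N. \<forall>n\<ge>N. nrm Q (X m \<ominus>\<^bsub>Q\<^esub> X n) < (1 / 2) ^ k" for k :: nat
      using X by (auto simp: Q.MCauchy_nrm_iff)
    then obtain M where M: "\<And>k m n. \<lbrakk>M k \<le> m; M k \<le> n\<rbrakk> \<Longrightarrow> nrm Q (X m \<ominus>\<^bsub>Q\<^esub> X n) < (1 / 2) ^ k"
      by metis
    \<comment> \<open>The summand \<open>k\<close> makes \<open>r\<close> strictly increasing, and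
      the sum makes both \<open>r k\<close> and \<open>r (Suc k)\<close> at least
      \<open>M k\<close>.\<close>
    define r where "r k = k + (\<Sum>j\<le>k. M j)" for k
    have r: "strict_mono r" by (auto simp: strict_mono_Suc_iff r_def)
    have "M k \<le> r k" "M k \<le> r (Suc k)" for k
      by (auto simp: r_def intro: order_trans[OF member_le_sum[of k "{..k}" M]])
    then have Xr: "nrm Q (X (r (Suc k)) \<ominus>\<^bsub>Q\<^esub> X (r k)) < (1 / 2) ^ k" for k
      using M by blast
    have "\<exists>s. \<forall>k. (s k \<in> carrier E \<and> q (s k) = X (r k)) \<and>
        nrm E (s (Suc k) \<ominus>\<^bsub>E\<^esub> s k) \<le> 1 * (1 / 2) ^ k"
    proof (rule dependent_nat_choice)
      show "\<exists>x. x \<in> carrier E \<and> q x = X (r 0)"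
        using XQ[of "r 0"] by (auto simp: carrier_Q)
    next
      fix x k assume x: "x \<in> carrier E \<and> q x = X (r k)"
      obtain z where z: "z \<in> carrier E" "q z = X (r (Suc k))"
        using XQ[of "r (Suc k)"] by (auto simp: carrier_Q)
      have "nrm Q (q (z \<ominus>\<^bsub>E\<^esub> x)) < (1 / 2) ^ k"
        using Xr[of k] x z q_diff[of z x] by simp
      \<comment> \<open>The strict inequality leaves room above the infimum, so the coset of z - x
        has a representative \<open>y\<close> of norm below 2^(-k). The next lift is then y + x
        instead of z.\<close>
      then obtain y where y: "y \<in> carrier E" "q y = q (z \<ominus>\<^bsub>E\<^esub> x)" "nrm E y < (1 / 2) ^ k"
        using nrm_q_approx[of "z \<ominus>\<^bsub>E\<^esub> x" "(1 / 2) ^ k - nrm Q (q (z \<ominus>\<^bsub>E\<^esub> x))"] x z(1) by auto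
      have eqs: "(z \<ominus>\<^bsub>E\<^esub> x) \<oplus>\<^bsub>E\<^esub> x = z" "(y \<oplus>\<^bsub>E\<^esub> x) \<ominus>\<^bsub>E\<^esub> x = y"
        using x z(1) y(1) by algebra+
      have "q (y \<oplus>\<^bsub>E\<^esub> x) = q (z \<ominus>\<^bsub>E\<^esub> x) \<oplus>\<^bsub>Q\<^esub> q x"
        using x y by (simp add: q_add[symmetric])
      also have "\<dots> = X (r (Suc k))"
        using x z eqs(1) q_add[of "z \<ominus>\<^bsub>E\<^esub> x" x] by simp
      finally show "\<exists>y. (y \<in> carrier E \<and> q y = X (r (Suc k))) \<and>
          nrm E (y \<ominus>\<^bsub>E\<^esub> x) \<le> 1 * (1 / 2) ^ k"
        using x y eqs(2) by (intro exI[of _ "y \<oplus>\<^bsub>E\<^esub> x"]) auto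
    qed
    then obtain s where s: "\<And>k. s k \<in> carrier E" "\<And>k. q (s k) = X (r k)"
      "\<And>k. nrm E (s (Suc k) \<ominus>\<^bsub>E\<^esub> s k) \<le> 1 * (1 / 2) ^ k"
      by blast
    obtain l where l: "l \<in> carrier E" "(\<lambda>k. nrm E (s k \<ominus>\<^bsub>E\<^esub> l)) \<longlonglongrightarrow> 0"
      using E.geometric_limit[OF s(1) s(3)] by blast
    have upper: "nrm Q (X (r k) \<ominus>\<^bsub>Q\<^esub> q l) \<le> nrm E (s k \<ominus>\<^bsub>E\<^esub> l)" for k
      using nrm_q_le[of "s k \<ominus>\<^bsub>E\<^esub> l"] s(1,2)[of k] l(1) q_diff[of "s k" l] by simp
    have qlQ: "q l \<in> carrier Q" using l(1) by (auto simp: carrier_Q)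
    then have lower: "0 \<le> nrm Q (X (r k) \<ominus>\<^bsub>Q\<^esub> q l)" for k
      using XQ by (intro Q.nrm_nonneg) auto
    have "(\<lambda>k. nrm Q (X (r k) \<ominus>\<^bsub>Q\<^esub> q l)) \<longlonglongrightarrow> 0"
      by (rule real_tendsto_sandwich[OF always_eventually always_eventually tendsto_const l(2)])
        (use lower upper in blast)+
    then have "limitin (ntopology Q) (X \<circ> r) (q l) sequentially"
      using XQ qlQ by (subst Q.limitin_nrm_iff) (auto simp: o_def)
    then show "\<exists>x. limitin (ntopology Q) X x sequentially"
      using Q.MS.MCauchy_convergent_subsequence[OF X r] by blast
  qed
qed

theorem banach_left_module_Q: "banach_left_module A Q"
proof (intro banach_left_module.intro A.banach_algebra_axioms banach_vs_Q banach_left_module_axioms.intro)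
  obtain C where C: "\<And>a x. \<lbrakk>a \<in> carrier A; x \<in> carrier E\<rbrakk> \<Longrightarrow> nrm E (act E a x) \<le> C * nrm A a * nrm E x"
    using act_bounded by blast
  \<comment> \<open>The absolute value is taken because \<open>nrm_q_leI\<close> demands a
    nonnegative factor and \<open>C\<close> may be negative.\<close>
  have "nrm Q (act Q a X) \<le> \<bar>C\<bar> * nrm A a * nrm Q X" if a: "a \<in> carrier A" and X: "X \<in> carrier Q" for a X
  proof -
    obtain x where x: "x \<in> carrier E" "X = q x" using X by (auto simp: carrier_Q)
    have "nrm Q (q (act E a x)) \<le> (\<bar>C\<bar> * nrm A a) * nrm Q (q x)"
    proof (rule nrm_q_leI[OF x(1)])
      fix y assume y: "y \<in> carrier E" "q y = q x"
      have "q (act E a x) = q (act E a y)" using a x y q_act by metis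
      then have "nrm Q (q (act E a x)) \<le> nrm E (act E a y)"
        using nrm_q_le[of "act E a y"] act_closed a y by simp
      also have "\<dots> \<le> C * nrm A a * nrm E y" using C a y by blast
      also have "\<dots> \<le> (\<bar>C\<bar> * nrm A a) * nrm E y"
        using A.nrm_nonneg[OF a] E.nrm_nonneg[OF y(1)] by (intro mult_right_mono) auto
      finally show "nrm Q (q (act E a x)) \<le> (\<bar>C\<bar> * nrm A a) * nrm E y" .
    qed (use A.nrm_nonneg[OF a] in auto)
    then show ?thesis using x a by (simp add: q_act)
  qed
  then show "\<exists>C. \<forall>a\<in>carrier A. \<forall>X\<in>carrier Q. nrm Q (act Q a X) \<le> C * nrm A a * nrm Q X"
    by blast
next
  fix a b X Y z assume a: "a \<in> carrier A" and b: "b \<in> carrier A" and "X \<in> carrier Q" "Y \<in> carrier Q"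
  then obtain x y where x: "x \<in> carrier E" "X = q x" and y: "y \<in> carrier E" "Y = q y"
    by (auto simp: carrier_Q)
  note [simp] = a b x y act_closed q_act q_add q_scale
  show "act Q a X \<in> carrier Q" by (simp add: carrier_Q)
  show "act Q (a \<otimes>\<^bsub>A\<^esub> b) X = act Q a (act Q b X)" by (simp add: A.mult_closed act_assoc)
  show "act Q (a \<oplus>\<^bsub>A\<^esub> b) X = act Q a X \<oplus>\<^bsub>Q\<^esub> act Q b X" by (simp add: act_add_left)
  show "act Q a (X \<oplus>\<^bsub>Q\<^esub> Y) = act Q a X \<oplus>\<^bsub>Q\<^esub> act Q a Y" by (simp add: act_add_right)
  show "act Q (z \<odot>\<^bsub>A\<^esub> a) X = z \<odot>\<^bsub>Q\<^esub> act Q a X" by (simp add: act_smult_left)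
  show "act Q a (z \<odot>\<^bsub>Q\<^esub> X) = z \<odot>\<^bsub>Q\<^esub> act Q a X" by (simp add: act_smult_right)
qed

end

section \<open>Semigroup algebras\<close>

text \<open>Regrouping by the values of \<pi>: X is in bijection with the pairs (\<pi> x, x), that
  is with the disjoint union of the fibres over S, to which Fubini applies. With \<pi> the semigroup
  product on S \<times> S, the fibre sums are convolutions.\<close>

lemma
  fixes h :: "'x \<Rightarrow> 'b::banach"
  assumes h: "h summable_on X" and \<pi>: "\<pi> ` X \<subseteq> S"
  shows infsum_fibres: "(\<Sum>\<^sub>\<infinity>s\<in>S. \<Sum>\<^sub>\<infinity>x\<in>{x \<in> X. \<pi> x = s}. h x) = infsum h X"
    and summable_on_fibres: "(\<lambda>s. \<Sum>\<^sub>\<infinity>x\<in>{x \<in> X. \<pi> x = s}. h x) summable_on S"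
proof -
  let ?\<Sigma> = "Sigma S (\<lambda>s. {x \<in> X. \<pi> x = s})"
  have bij: "bij_betw snd ?\<Sigma> X"
    using \<pi> by (intro bij_betwI[where g = "\<lambda>x. (\<pi> x, x)"]) auto
  have summable: "(\<lambda>(s, x). h x) summable_on ?\<Sigma>"
    using summable_on_reindex_bij_betw[OF bij, of h] h by (simp add: case_prod_unfold)
  have "infsum (\<lambda>(s, x). h x) ?\<Sigma> = infsum h X"
    using infsum_reindex_bij_betw[OF bij, of h] by (simp add: case_prod_unfold)
  then show "(\<Sum>\<^sub>\<infinity>s\<in>S. \<Sum>\<^sub>\<infinity>x\<in>{x \<in> X. \<pi> x = s}. h x) = infsum h X"
    using infsum_Sigma'_banach[OF summable] by simp
  show "(\<lambda>s. \<Sum>\<^sub>\<infinity>x\<in>{x \<in> X. \<pi> x = s}. h x) summable_on S"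
    by (rule summable_on_Sigma_banach[OF summable])
qed

lemma abs_summable_on_times:
  fixes f :: "'a \<Rightarrow> 'c::real_normed_div_algebra" and g :: "'b \<Rightarrow> 'c"
  assumes f: "f abs_summable_on A" and g: "g abs_summable_on B"
  shows "(\<lambda>(x, y). f x * g y) abs_summable_on A \<times> B"
    and "(\<Sum>\<^sub>\<infinity>(x, y)\<in>A \<times> B. norm (f x * g y)) = (\<Sum>\<^sub>\<infinity>x\<in>A. norm (f x)) * (\<Sum>\<^sub>\<infinity>y\<in>B. norm (g y))"
proof -
  have eq: "(\<Sum>\<^sub>\<infinity>y\<in>B. norm (f x * g y)) = norm (f x) * (\<Sum>\<^sub>\<infinity>y\<in>B. norm (g y))" for x
    by (simp add: norm_mult infsum_cmult_right')
  have "(\<lambda>x. norm (f x) * (\<Sum>\<^sub>\<infinity>y\<in>B. norm (g y))) abs_summable_on A"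
    using f by (auto simp: abs_mult intro: summable_on_cmult_left)
  moreover have "(\<lambda>y. f x * g y) abs_summable_on B" for x
    using g by (simp add: norm_mult summable_on_cmult_right)
  ultimately show *: "(\<lambda>(x, y). f x * g y) abs_summable_on A \<times> B"
    unfolding abs_summable_on_Sigma_iff prod.case by (auto simp only: eq)
  have "(\<Sum>\<^sub>\<infinity>(x, y)\<in>A \<times> B. norm (f x * g y)) = (\<Sum>\<^sub>\<infinity>x\<in>A. \<Sum>\<^sub>\<infinity>y\<in>B. norm (f x * g y))"
    using * by (intro infsum_Sigma'_banach[symmetric]) (simp add: case_prod_unfold)
  then show "(\<Sum>\<^sub>\<infinity>(x, y)\<in>A \<times> B. norm (f x * g y)) = (\<Sum>\<^sub>\<infinity>x\<in>A. norm (f x)) * (\<Sum>\<^sub>\<infinity>y\<in>B. norm (g y))"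
    by (simp add: norm_mult infsum_cmult_right' infsum_cmult_left')
qed

text \<open>Hoelder's inequality for the exponents 1 and \<infinity>.\<close>

lemma abs_summable_on_bounded_mult:
  fixes f p :: "'a \<Rightarrow> complex"
  assumes f: "f abs_summable_on A" and p: "\<And>x. x \<in> A \<Longrightarrow> norm (p x) \<le> B"
  shows "(\<lambda>x. f x * p x) abs_summable_on A"
    and "norm (\<Sum>\<^sub>\<infinity>x\<in>A. f x * p x) \<le> (\<Sum>\<^sub>\<infinity>x\<in>A. norm (f x)) * B"
proof -
  have le: "norm (f x * p x) \<le> norm (f x) * B" if "x \<in> A" for x
    using p[OF that] by (simp add: norm_mult mult_left_mono)
  have s: "(\<lambda>x. norm (f x) * B) summable_on A"
    using f by (rule summable_on_cmult_left)
  show *: "(\<lambda>x. f x * p x) abs_summable_on A"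
    by (rule summable_on_comparison_test[OF s le]) auto
  have "norm (\<Sum>\<^sub>\<infinity>x\<in>A. f x * p x) \<le> (\<Sum>\<^sub>\<infinity>x\<in>A. norm (f x * p x))"
    by (rule norm_infsum_bound[OF *])
  also have "\<dots> \<le> (\<Sum>\<^sub>\<infinity>x\<in>A. norm (f x) * B)"
    by (rule infsum_mono[OF * s le])
  finally show "norm (\<Sum>\<^sub>\<infinity>x\<in>A. f x * p x) \<le> (\<Sum>\<^sub>\<infinity>x\<in>A. norm (f x)) * B"
    by (simp add: infsum_cmult_left')
qed

lemma infsum_single:
  assumes "\<And>x. x \<in> A \<Longrightarrow> x \<noteq> a \<Longrightarrow> f x = 0" "a \<in> A"
  shows "infsum f A = f a"
proof -
  have "infsum f A = infsum f {a}"
    using assms by (intro infsum_cong_neutral) auto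
  then show ?thesis by simp
qed

section \<open>The convolution algebra of a semigroup\<close>

locale semigroup_on =
  fixes S :: "'s set" and m :: "'s \<Rightarrow> 's \<Rightarrow> 's"
  assumes closed: "\<lbrakk>u \<in> S; v \<in> S\<rbrakk> \<Longrightarrow> m u v \<in> S"
    and assoc: "\<lbrakk>u \<in> S; v \<in> S; w \<in> S\<rbrakk> \<Longrightarrow> m (m u v) w = m u (m v w)"
begin

abbreviation L where "L \<equiv> ell1 S m"

abbreviation conv (infixl \<open>\<star>\<close> 70) where "f \<star> g \<equiv> f \<otimes>\<^bsub>L\<^esub> g"

lemma mem_L_iff: "f \<in> carrier L \<longleftrightarrow> (\<forall>s. s \<notin> S \<longrightarrow> f s = 0) \<and> f abs_summable_on S"
  by (simp add: ell1_def)

lemma L_off: "f \<in> carrier L \<Longrightarrow> s \<notin> S \<Longrightarrow> f s = 0"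
  by (simp add: mem_L_iff)

lemma L_abs_summable: "f \<in> carrier L \<Longrightarrow> f abs_summable_on S"
  by (simp add: mem_L_iff)

lemma L_simps [simp]:
  "f \<oplus>\<^bsub>L\<^esub> g = (\<lambda>s. f s + g s)" "c \<odot>\<^bsub>L\<^esub> f = (\<lambda>s. c * f s)" "\<zero>\<^bsub>L\<^esub> = (\<lambda>s. 0)"
  "nrm L f = (\<Sum>\<^sub>\<infinity>s\<in>S. norm (f s))"
  by (simp_all add: ell1_def)

lemma add_mem_L: "\<lbrakk>f \<in> carrier L; g \<in> carrier L\<rbrakk> \<Longrightarrow> (\<lambda>s. f s + g s) \<in> carrier L"
  unfolding mem_L_iff
  by (auto intro: summable_on_comparison_test[OF summable_on_add norm_triangle_ineq])

lemma scale_mem_L: "f \<in> carrier L \<Longrightarrow> (\<lambda>s. c * f s) \<in> carrier L"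
  by (auto simp: mem_L_iff norm_mult intro!: summable_on_cmult_right)

lemma diff_mem_L: "\<lbrakk>f \<in> carrier L; g \<in> carrier L\<rbrakk> \<Longrightarrow> (\<lambda>s. f s - g s) \<in> carrier L"
  using add_mem_L[of f "\<lambda>s. (- 1) * g s"] scale_mem_L[of g "- 1"] by simp

lemma normed_vs_L: "normed_vs L"
proof (intro normed_vs.intro normed_vs_axioms.intro moduleI abelian_groupI)
  show "cring complex_ring"
    by unfold_locales
      (auto simp: complex_ring_def algebra_simps Units_def intro: exI[of _ "- x" for x])
  fix f assume f: "f \<in> carrier L"
  show "\<exists>g\<in>carrier L. g \<oplus>\<^bsub>L\<^esub> f = \<zero>\<^bsub>L\<^esub>"
    using scale_mem_L[OF f, of "- 1"] by (intro bexI[of _ "\<lambda>s. (- 1) * f s"]) auto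
  show "0 \<le> nrm L f" by (simp add: infsum_nonneg)
  show "nrm L f = 0 \<longleftrightarrow> f = \<zero>\<^bsub>L\<^esub>"
  proof
    assume "nrm L f = 0"
    then have "f s = 0" if "s \<in> S" for s
      using nonneg_infsum_le_0D[of "\<lambda>s. norm (f s)" S s] L_abs_summable[OF f] that by simp
    then show "f = \<zero>\<^bsub>L\<^esub>" using L_off[OF f] by auto
  qed simp
  show "nrm L (c \<odot>\<^bsub>L\<^esub> f) = norm c * nrm L f" for c
    by (simp add: norm_mult infsum_cmult_right')
  fix g assume g: "g \<in> carrier L"
  have "(\<Sum>\<^sub>\<infinity>s\<in>S. norm (f s + g s)) \<le> (\<Sum>\<^sub>\<infinity>s\<in>S. norm (f s) + norm (g s))"
    using L_abs_summable[OF f] L_abs_summable[OF g] L_abs_summable[OF add_mem_L[OF f g]]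
    by (intro infsum_mono summable_on_add norm_triangle_ineq) auto
  then show "nrm L (f \<oplus>\<^bsub>L\<^esub> g) \<le> nrm L f + nrm L g"
    using L_abs_summable[OF f] L_abs_summable[OF g] by (simp add: infsum_add)
qed (auto simp: complex_ring_def algebra_simps add_mem_L scale_mem_L mem_L_iff[of "\<lambda>s. 0"])

sublocale L: normed_vs L
  by (rule normed_vs_L)

lemma minus_L:
  assumes f: "f \<in> carrier L" and g: "g \<in> carrier L"
  shows "f \<ominus>\<^bsub>L\<^esub> g = (\<lambda>s. f s - g s)"
  using L.scale_minus_one[OF g] by (simp add: a_minus_def fun_eq_iff)

text \<open>A Cauchy sequence converges pointwise. Finite partial sums of the differences are
  bounded uniformly, and this bound passes to the pointwise limit, giving both summability and
  convergence in norm.\<close>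

lemma banach_vs_L: "banach_vs L"
proof (intro banach_vs.intro normed_vs_L banach_vs_axioms.intro)
  show "L.MS.mcomplete"
    unfolding L.MS.mcomplete_def
  proof (intro allI impI)
    fix F assume F: "L.MS.MCauchy F"
    then have FL: "F k \<in> carrier L" for k by (auto simp: L.MS.MCauchy_def)
    have cauchy: "\<exists>N. \<forall>k\<ge>N. \<forall>l\<ge>N. (\<Sum>\<^sub>\<infinity>s\<in>S. norm (F k s - F l s)) < \<epsilon>" if "0 < \<epsilon>" for \<epsilon>
      using F that by (simp add: L.MCauchy_nrm_iff minus_L FL)
    have partial: "(\<Sum>s\<in>X. norm (F k s - F l s)) \<le> (\<Sum>\<^sub>\<infinity>s\<in>S. norm (F k s - F l s))"
      if "finite X" "X \<subseteq> S" for X k l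
      using that L_abs_summable[OF diff_mem_L[OF FL FL]] by (intro finite_sum_le_infsum) auto
    have "Cauchy (\<lambda>k. F k s)" if s: "s \<in> S" for s
    proof (rule CauchyI)
      fix \<epsilon> :: real assume "0 < \<epsilon>"
      then obtain N where N: "\<And>k l. \<lbrakk>N \<le> k; N \<le> l\<rbrakk> \<Longrightarrow> (\<Sum>\<^sub>\<infinity>s\<in>S. norm (F k s - F l s)) < \<epsilon>"
        using cauchy by blast
      have "norm (F k s - F l s) < \<epsilon>" if "N \<le> k" "N \<le> l" for k l
        using partial[of "{s}" k l] N[OF that] s by simp
      then show "\<exists>N. \<forall>k\<ge>N. \<forall>l\<ge>N. norm (F k s - F l s) < \<epsilon>" by blast
    qed
    then have "convergent (\<lambda>k. F k s)" for s
      using L_off[OF FL] by (cases "s \<in> S") (auto simp: Cauchy_convergent convergent_const)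
    then obtain f where f: "\<And>s. (\<lambda>k. F k s) \<longlonglongrightarrow> f s"
      unfolding convergent_def by metis
    have f_off: "f s = 0" if "s \<notin> S" for s
      using f[of s] L_off[OF FL that] by (simp add: LIMSEQ_const_iff)
    have tail: "\<exists>N. \<forall>k\<ge>N. (\<lambda>s. F k s - f s) \<in> carrier L \<and> nrm L (\<lambda>s. F k s - f s) \<le> \<epsilon>"
      if "0 < \<epsilon>" for \<epsilon>
    proof -
      obtain N where N: "\<And>k l. \<lbrakk>N \<le> k; N \<le> l\<rbrakk> \<Longrightarrow> (\<Sum>\<^sub>\<infinity>s\<in>S. norm (F k s - F l s)) < \<epsilon>"
        using cauchy \<open>0 < \<epsilon>\<close> by blast
      have "(\<lambda>s. F k s - f s) \<in> carrier L \<and> nrm L (\<lambda>s. F k s - f s) \<le> \<epsilon>" if k: "N \<le> k" for k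
      proof -
        \<comment> \<open>Only finitely many points are involved, so the limit in l may be taken
          inside the sum.\<close>
        have le: "(\<Sum>s\<in>X. norm (F k s - f s)) \<le> \<epsilon>" if X: "finite X" "X \<subseteq> S" for X
        proof (rule LIMSEQ_le_const2)
          show "(\<lambda>l. \<Sum>s\<in>X. norm (F k s - F l s)) \<longlonglongrightarrow> (\<Sum>s\<in>X. norm (F k s - f s))"
            by (intro tendsto_intros f)
          show "\<exists>M. \<forall>l\<ge>M. (\<Sum>s\<in>X. norm (F k s - F l s)) \<le> \<epsilon>"
            using partial[OF X] N[OF k] by (meson less_imp_le order_trans)
        qed
        then have summable: "(\<lambda>s. F k s - f s) abs_summable_on S"
          by (intro nonneg_bdd_above_summable_on bdd_aboveI2[where M = \<epsilon>]) auto
        then show ?thesis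
          using le L_off[OF FL] f_off by (auto simp: mem_L_iff intro: infsum_le_finite_sums)
      qed
      then show ?thesis by blast
    qed
    \<comment> \<open>Membership of the limit follows from f = F_N - (F_N - f).\<close>
    obtain N where "(\<lambda>s. F N s - f s) \<in> carrier L"
      using tail[of 1] by auto
    then have fL: "f \<in> carrier L"
      using diff_mem_L[OF FL[of N]] by fastforce
    have "(\<lambda>k. nrm L (F k \<ominus>\<^bsub>L\<^esub> f)) \<longlonglongrightarrow> 0"
    proof (rule LIMSEQ_I)
      fix \<epsilon> :: real assume "0 < \<epsilon>"
      then obtain N where N: "\<And>k. N \<le> k \<Longrightarrow> nrm L (\<lambda>s. F k s - f s) \<le> \<epsilon> / 2"
        using tail[of "\<epsilon> / 2"] by auto
      have "norm (nrm L (F k \<ominus>\<^bsub>L\<^esub> f) - 0) < \<epsilon>" if "N \<le> k" for k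
        using N[OF that] \<open>0 < \<epsilon>\<close> by (simp add: minus_L FL fL abs_of_nonneg infsum_nonneg)
      then show "\<exists>N. \<forall>k\<ge>N. norm (nrm L (F k \<ominus>\<^bsub>L\<^esub> f) - 0) < \<epsilon>" by blast
    qed
    then show "\<exists>f. limitin (ntopology L) F f sequentially"
      using FL fL by (subst L.limitin_nrm_iff) auto
  qed
qed

text \<open>Rewrites the index set literally as a fibre of the product map on S \<times> S, the
  shape expected by \<open>infsum_fibres\<close>.\<close>

lemma conv_eq: "(f \<star> g) s = (\<Sum>\<^sub>\<infinity>x\<in>{x \<in> S \<times> S. (case x of (u, v) \<Rightarrow> m u v) = s}. case x of (u, v) \<Rightarrow> f u * g v)"
proof -
  have "{(u, v). u \<in> S \<and> v \<in> S \<and> m u v = s} = {x \<in> S \<times> S. (case x of (u, v) \<Rightarrow> m u v) = s}"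
    by auto
  then show ?thesis by (simp add: ell1_def)
qed

lemma m_image: "(\<lambda>(u, v). m u v) ` (S \<times> S) \<subseteq> S"
  using closed by auto

text \<open>The value of the convolution at s is dominated by the sum of |f(u) g(v)| over the fibre
  of s; these fibre sums add up to the sum over S \<times> S, which is the product of the
  norms.\<close>

lemma
  assumes f: "f \<in> carrier L" and g: "g \<in> carrier L"
  shows conv_mem_L: "f \<star> g \<in> carrier L" and nrm_conv: "nrm L (f \<star> g) \<le> nrm L f * nrm L g"
proof -
  note fg = abs_summable_on_times[OF L_abs_summable[OF f] L_abs_summable[OF g]]
  let ?n = "\<lambda>s. \<Sum>\<^sub>\<infinity>x\<in>{x \<in> S \<times> S. (case x of (u, v) \<Rightarrow> m u v) = s}. norm (case x of (u, v) \<Rightarrow> f u * g v)"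
  have n: "?n summable_on S" by (rule summable_on_fibres[OF fg(1) m_image])
  have le: "norm ((f \<star> g) s) \<le> ?n s" for s
    unfolding conv_eq
    by (rule norm_infsum_bound) (rule summable_on_subset_banach[OF fg(1)], auto)
  have "(f \<star> g) s = 0" if "s \<notin> S" for s
  proof -
    have "{x \<in> S \<times> S. (case x of (u, v) \<Rightarrow> m u v) = s} = {}" using that closed by auto
    then show ?thesis unfolding conv_eq by (simp only: infsum_empty)
  qed
  moreover have summable: "(f \<star> g) abs_summable_on S"
    by (rule summable_on_comparison_test[OF n le]) auto
  ultimately show "f \<star> g \<in> carrier L"
    by (simp add: mem_L_iff)
  have "nrm L (f \<star> g) \<le> infsum ?n S"
    using infsum_mono[OF summable n le] by simp
  also have "\<dots> = (\<Sum>\<^sub>\<infinity>x\<in>S \<times> S. norm (case x of (u, v) \<Rightarrow> f u * g v))"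
    by (rule infsum_fibres[OF fg(1) m_image])
  also have "\<dots> = nrm L f * nrm L g"
    using fg(2) by (simp add: case_prod_unfold)
  finally show "nrm L (f \<star> g) \<le> nrm L f * nrm L g" .
qed

text \<open>
  Pairing a convolution with a bounded function turns it into an iterated sum; algebraic
  identities between convolutions then follow by testing against indicator functions.
\<close>

lemma conv_pairing:
  assumes f: "f \<in> carrier L" and g: "g \<in> carrier L" and p: "\<And>s. s \<in> S \<Longrightarrow> norm (p s) \<le> B"
  shows "(\<Sum>\<^sub>\<infinity>s\<in>S. (f \<star> g) s * p s) = (\<Sum>\<^sub>\<infinity>u\<in>S. f u * (\<Sum>\<^sub>\<infinity>v\<in>S. g v * p (m u v)))"
proof -
  note fg = abs_summable_on_times(1)[OF L_abs_summable[OF f] L_abs_summable[OF g]]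
  let ?h = "\<lambda>x. (case x of (u, v) \<Rightarrow> f u * g v) * p (case x of (u, v) \<Rightarrow> m u v)"
  have "norm (p (case x of (u, v) \<Rightarrow> m u v)) \<le> B" if "x \<in> S \<times> S" for x
    using that p closed by auto
  then have "?h abs_summable_on S \<times> S"
    by (rule abs_summable_on_bounded_mult[OF fg])
  then have h: "?h summable_on S \<times> S"
    by (rule abs_summable_summable)
  \<comment> \<open>On the fibre over s the factor p(uv) is constantly p(s), so it may be moved
    inside.\<close>
  have "(f \<star> g) s * p s = (\<Sum>\<^sub>\<infinity>x\<in>{x \<in> S \<times> S. (case x of (u, v) \<Rightarrow> m u v) = s}. ?h x)" for s
    unfolding conv_eq infsum_cmult_left'[symmetric] by (rule infsum_cong) auto
  then have "(\<Sum>\<^sub>\<infinity>s\<in>S. (f \<star> g) s * p s) = infsum ?h (S \<times> S)"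
    using infsum_fibres[OF h m_image] by simp
  also have "\<dots> = (\<Sum>\<^sub>\<infinity>u\<in>S. \<Sum>\<^sub>\<infinity>v\<in>S. f u * g v * p (m u v))"
    using infsum_Sigma_banach[OF h] by simp
  finally show ?thesis
    by (simp add: mult.assoc infsum_cmult_right')
qed

lemma eval_eq_pairing:
  fixes f :: "'s \<Rightarrow> complex"
  assumes "s \<in> S"
  shows "f s = (\<Sum>\<^sub>\<infinity>t\<in>S. f t * (if t = s then 1 else 0))"
  by (subst infsum_single[where a = s]) (use assms in auto)

lemma conv_eval:
  assumes "f \<in> carrier L" "g \<in> carrier L" "s \<in> S"
  shows "(f \<star> g) s = (\<Sum>\<^sub>\<infinity>u\<in>S. f u * (\<Sum>\<^sub>\<infinity>v\<in>S. g v * (if m u v = s then 1 else 0)))"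
  by (subst eval_eq_pairing[OF assms(3)]) (rule conv_pairing[OF assms(1,2), where B = 1], simp)

text \<open>The value at s is the pairing of f \<star> g with the function sending t to the sum of
  those h(w) with tw = s. That function is bounded by the norm of h, so pairing applies again and
  yields a triple iterated sum, in which associativity of \<open>m\<close> acts inside the
  indicator; the sum is then folded up the other way.\<close>

lemma conv_assoc:
  assumes f: "f \<in> carrier L" and g: "g \<in> carrier L" and h: "h \<in> carrier L"
  shows "(f \<star> g) \<star> h = f \<star> (g \<star> h)"
proof
  fix s
  show "((f \<star> g) \<star> h) s = (f \<star> (g \<star> h)) s"
  proof (cases "s \<in> S")
    case True
    let ?p = "\<lambda>t. if t = s then 1 else 0 :: complex"
    have "norm (\<Sum>\<^sub>\<infinity>w\<in>S. h w * ?p (m t w)) \<le> nrm L h" for t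
      using abs_summable_on_bounded_mult(2)[OF L_abs_summable[OF h], of "\<lambda>w. ?p (m t w)" 1] by simp
    then have "((f \<star> g) \<star> h) s =
        (\<Sum>\<^sub>\<infinity>u\<in>S. f u * (\<Sum>\<^sub>\<infinity>v\<in>S. g v * (\<Sum>\<^sub>\<infinity>w\<in>S. h w * ?p (m (m u v) w))))"
      unfolding conv_eval[OF conv_mem_L[OF f g] h True]
      by (intro conv_pairing[OF f g]) auto
    also have "\<dots> = (\<Sum>\<^sub>\<infinity>u\<in>S. f u * (\<Sum>\<^sub>\<infinity>v\<in>S. g v * (\<Sum>\<^sub>\<infinity>w\<in>S. h w * ?p (m u (m v w)))))"
      by (intro infsum_cong arg_cong2[where f = "(*)"] refl) (simp add: assoc)
    also have "\<dots> = (\<Sum>\<^sub>\<infinity>u\<in>S. f u * (\<Sum>\<^sub>\<infinity>x\<in>S. (g \<star> h) x * ?p (m u x)))"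
      by (subst conv_pairing[OF g h, where B = 1]) auto
    also have "\<dots> = (f \<star> (g \<star> h)) s"
      by (rule conv_eval[OF f conv_mem_L[OF g h] True, symmetric])
    finally show ?thesis .
  next
    case False
    then show ?thesis
      using L_off[OF conv_mem_L[OF conv_mem_L[OF f g] h]] L_off[OF conv_mem_L[OF f conv_mem_L[OF g h]]]
      by simp
  qed
qed

lemma conv_fibre_summable:
  assumes f: "f \<in> carrier L" and g: "g \<in> carrier L"
  shows "(\<lambda>(u, v). f u * g v) summable_on {x \<in> S \<times> S. (case x of (u, v) \<Rightarrow> m u v) = s}"
  by (rule summable_on_subset_banach[OF abs_summable_summable[OF abs_summable_on_times(1)[OF
          L_abs_summable[OF f] L_abs_summable[OF g]]]]) auto

lemma banach_algebra_L: "banach_algebra L"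
proof (intro banach_algebra.intro banach_vs_L banach_algebra_axioms.intro)
  fix f g h assume f: "f \<in> carrier L" and g: "g \<in> carrier L" and h: "h \<in> carrier L"
  show "f \<star> g \<in> carrier L" "nrm L (f \<star> g) \<le> nrm L f * nrm L g" "(f \<star> g) \<star> h = f \<star> (g \<star> h)"
    using conv_mem_L nrm_conv conv_assoc f g h by auto
  show "(f \<oplus>\<^bsub>L\<^esub> g) \<star> h = f \<star> h \<oplus>\<^bsub>L\<^esub> g \<star> h"
    unfolding L_simps conv_eq fun_eq_iff
    by (subst infsum_add[symmetric, OF conv_fibre_summable[OF f h] conv_fibre_summable[OF g h]])
      (simp add: case_prod_unfold distrib_right)
  show "f \<star> (g \<oplus>\<^bsub>L\<^esub> h) = f \<star> g \<oplus>\<^bsub>L\<^esub> f \<star> h"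
    unfolding L_simps conv_eq fun_eq_iff
    by (subst infsum_add[symmetric, OF conv_fibre_summable[OF f g] conv_fibre_summable[OF f h]])
      (simp add: case_prod_unfold distrib_left)
  show "(z \<odot>\<^bsub>L\<^esub> f) \<star> g = z \<odot>\<^bsub>L\<^esub> (f \<star> g)" "f \<star> (z \<odot>\<^bsub>L\<^esub> g) = z \<odot>\<^bsub>L\<^esub> (f \<star> g)" for z
    unfolding L_simps conv_eq fun_eq_iff infsum_cmult_right'[symmetric]
    by (simp_all add: case_prod_unfold mult_ac)
qed

lemma conv_commute:
  assumes "\<And>u v. \<lbrakk>u \<in> S; v \<in> S\<rbrakk> \<Longrightarrow> m u v = m v u"
  shows "f \<star> g = g \<star> f"
proof
  fix s
  let ?X = "{x \<in> S \<times> S. (case x of (u, v) \<Rightarrow> m u v) = s}"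
  have "bij_betw prod.swap ?X ?X"
    using assms by (intro bij_betwI[where g = prod.swap]) auto
  from infsum_reindex_bij_betw[OF this, of "\<lambda>(u, v). g u * f v"]
  show "(f \<star> g) s = (g \<star> f) s"
    unfolding conv_eq by (simp add: case_prod_unfold mult.commute)
qed

lemma norm_le_nrm_L:
  assumes f: "f \<in> carrier L"
  shows "norm (f s) \<le> nrm L f"
proof (cases "s \<in> S")
  case True
  then show ?thesis
    using finite_sum_le_infsum[OF L_abs_summable[OF f], of "{s}"] by simp
next
  case False
  then show ?thesis using L_off[OF f] by (simp add: infsum_nonneg)
qed

lemma point_mass_mem_L:
  assumes "s \<in> S"
  shows "point_mass s \<in> carrier L"
proof -
  have "point_mass s abs_summable_on S \<longleftrightarrow> point_mass s abs_summable_on {s}"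
    using assms by (intro summable_on_cong_neutral) (auto simp: point_mass_def)
  then show ?thesis
    using assms by (auto simp: mem_L_iff point_mass_def)
qed

end

section \<open>The semigroup of positive integers under minimum\<close>

interpretation N_min: semigroup_on "{1..} :: nat set" min
  by unfold_locales auto

text \<open>Otherwise the simplifier turns \<open>{1..}\<close> into \<open>{Suc 0..}\<close>, which the simp rules for the algebra miss.\<close>

declare One_nat_def [simp del]

text \<open>Presents the character as a pairing with a bounded indicator function on the whole index
  set, so that \<open>conv_pairing\<close> applies.\<close>

lemma phi_n_pairing:
  assumes "1 \<le> n"
  shows "phi_n n f = (\<Sum>\<^sub>\<infinity>s\<in>{1..}. f s * (if n \<le> s then 1 else 0))"
  unfolding phi_n_def using assms by (intro infsum_cong_neutral) auto

text \<open>Multiplicativity rests on min u v \<ge> n holding exactly when u \<ge> n and v \<ge> n: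
  the indicator of \<open>{n..}\<close> is a multiplicative function on the semigroup. The point
  mass at \<open>n\<close> shows that the character is non-zero.\<close>

lemma phi_n_characters:
  assumes n: "1 \<le> n"
  shows "phi_n n \<in> characters ell1_N_min"
  unfolding characters_def ell1_N_min_def
proof (intro CollectI conjI ballI allI)
  fix f g assume f: "f \<in> carrier N_min.L" and g: "g \<in> carrier N_min.L"
  have "f summable_on {n..}" "g summable_on {n..}"
    using summable_on_subset_banach[OF abs_summable_summable[OF N_min.L_abs_summable]] f g n
    by (simp_all add: atLeast_subset_iff)
  then show "phi_n n (f \<oplus>\<^bsub>N_min.L\<^esub> g) = phi_n n f + phi_n n g"
    by (simp add: phi_n_def infsum_add)
  show "phi_n n (c \<odot>\<^bsub>N_min.L\<^esub> f) = c * phi_n n f" for c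
    by (simp add: phi_n_def infsum_cmult_right')
  let ?p = "\<lambda>s. if n \<le> s then 1 else 0 :: complex"
  have "phi_n n (f \<otimes>\<^bsub>N_min.L\<^esub> g)
      = (\<Sum>\<^sub>\<infinity>u\<in>{1..}. f u * (\<Sum>\<^sub>\<infinity>v\<in>{1..}. g v * ?p (min u v)))"
    unfolding phi_n_pairing[OF n] by (rule N_min.conv_pairing[OF f g, where B = 1]) simp
  also have "\<dots> = (\<Sum>\<^sub>\<infinity>u\<in>{1..}. f u * ?p u * phi_n n g)"
  proof (rule infsum_cong)
    fix u
    have "(\<Sum>\<^sub>\<infinity>v\<in>{1..}. g v * ?p (min u v)) = ?p u * phi_n n g"
      unfolding phi_n_pairing[OF n] infsum_cmult_right'[symmetric] by (rule infsum_cong) simp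
    then show "f u * (\<Sum>\<^sub>\<infinity>v\<in>{1..}. g v * ?p (min u v)) = f u * ?p u * phi_n n g"
      by (simp only: mult.assoc)
  qed
  also have "\<dots> = phi_n n f * phi_n n g"
    unfolding phi_n_pairing[OF n, of f] by (rule infsum_cmult_left')
  finally show "phi_n n (f \<otimes>\<^bsub>N_min.L\<^esub> g) = phi_n n f * phi_n n g" .
next
  have "phi_n n (point_mass n) = 1"
    unfolding phi_n_def by (subst infsum_single[where a = n]) (auto simp: point_mass_def)
  then show "\<exists>f\<in>carrier N_min.L. phi_n n f \<noteq> 0"
    using N_min.point_mass_mem_L[of n] n by (intro bexI[of _ "point_mass n"]) auto
qed

text \<open>The guard \<open>2 \<le> n\<close> realises the convention that the point mass at 0 is
  zero. Otherwise \<open>e_n 1\<close> would have the value -1 at 0, outside the index set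
  \<open>{1..}\<close>, and would not belong to the algebra.\<close>

definition e_n :: "nat \<Rightarrow> nat \<Rightarrow> complex"
  where "e_n n = (\<lambda>t. if t = n then 1 else if t = n - 1 \<and> 2 \<le> n then - 1 else 0)"

lemma infsum_e_n:
  assumes "1 \<le> n"
  shows "(\<Sum>\<^sub>\<infinity>v\<in>{1..}. e_n n v * c v) = c n - (if 2 \<le> n then c (n - 1) else 0)"
proof (cases "2 \<le> n")
  case True
  have "(\<Sum>\<^sub>\<infinity>v\<in>{1..}. e_n n v * c v) = (\<Sum>\<^sub>\<infinity>v\<in>{n - 1, n}. e_n n v * c v)"
    using True by (intro infsum_cong_neutral) (auto simp: e_n_def)
  then show ?thesis using True by (simp add: e_n_def)
next
  case False
  then have "n = 1" using assms by simp
  then show ?thesis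
    by (subst infsum_single[where a = 1]) (auto simp: e_n_def)
qed

lemma e_n_mem:
  assumes n: "1 \<le> n"
  shows "e_n n \<in> carrier N_min.L"
proof (cases "2 \<le> n")
  case True
  have "e_n n = (\<lambda>t. point_mass n t - point_mass (n - 1) t)"
    using True by (auto simp: fun_eq_iff e_n_def point_mass_def)
  then show ?thesis
    using N_min.diff_mem_L[OF N_min.point_mass_mem_L N_min.point_mass_mem_L, of n "n - 1"] True
    by simp
next
  case False
  then have "e_n n = point_mass n"
    by (auto simp: e_n_def point_mass_def)
  then show ?thesis using N_min.point_mass_mem_L[of n] n by simp
qed

text \<open>Multiplication by the point mass at u sends n and n - 1 to their minima with u. For u <
  n both minima are u and cancel; for u \<ge> n they are n and n - 1, and \<open>e_n n\<close> is
  reproduced. Summing over u leaves the total weight of \<open>a\<close> on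
  \<open>{n..}\<close>.\<close>

lemma conv_e_n:
  assumes n: "1 \<le> n" and a: "a \<in> carrier N_min.L"
  shows "a \<otimes>\<^bsub>N_min.L\<^esub> e_n n = phi_n n a \<odot>\<^bsub>N_min.L\<^esub> e_n n"
proof
  fix t
  show "(a \<otimes>\<^bsub>N_min.L\<^esub> e_n n) t = (phi_n n a \<odot>\<^bsub>N_min.L\<^esub> e_n n) t"
  proof (cases "t \<in> {1..}")
    case True
    have inner: "(\<Sum>\<^sub>\<infinity>v\<in>{1..}. e_n n v * (if min u v = t then 1 else 0)) = (if n \<le> u then 1 else 0) * e_n n t"
      if "u \<in> {1..}" for u
      unfolding infsum_e_n[OF n] using that True n by (auto simp: e_n_def min_def)
    have "(a \<otimes>\<^bsub>N_min.L\<^esub> e_n n) t = (\<Sum>\<^sub>\<infinity>u\<in>{1..}. a u * (if n \<le> u then 1 else 0) * e_n n t)"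
      unfolding N_min.conv_eval[OF a e_n_mem[OF n] True]
      by (rule infsum_cong) (simp only: inner mult.assoc)
    also have "\<dots> = phi_n n a * e_n n t"
      unfolding phi_n_pairing[OF n] by (rule infsum_cmult_left')
    finally show ?thesis by simp
  next
    case False
    then show ?thesis
      using N_min.L_off[OF N_min.conv_mem_L[OF a e_n_mem[OF n]]] N_min.L_off[OF e_n_mem[OF n]] by simp
  qed
qed

theorem phi_n_injective:
  fixes E :: "(nat \<Rightarrow> complex, 'e) normed_module"
  assumes n: "1 \<le> n" and E: "banach_left_module ell1_N_min E"
  shows "phi_injective TYPE('f) TYPE('k) ell1_N_min (phi_n n) E"
proof (rule phi_injective_of_minimal_idempotent[OF E phi_n_characters[OF n], where e = "e_n n"])
  show "e_n n \<in> carrier ell1_N_min"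
    using e_n_mem[OF n] by (simp add: ell1_N_min_def)
  have "phi_n n (e_n n) = (\<Sum>\<^sub>\<infinity>v\<in>{1..}. e_n n v * (if n \<le> v then 1 else 0))"
    by (rule phi_n_pairing[OF n])
  also have "\<dots> = 1" unfolding infsum_e_n[OF n] using n by auto
  finally show "phi_n n (e_n n) = 1" .
  fix a assume a: "a \<in> carrier ell1_N_min"
  then show *: "a \<otimes>\<^bsub>ell1_N_min\<^esub> e_n n = phi_n n a \<odot>\<^bsub>ell1_N_min\<^esub> e_n n"
    using conv_e_n[OF n] unfolding ell1_N_min_def by blast
  have "e_n n \<otimes>\<^bsub>ell1_N_min\<^esub> a = a \<otimes>\<^bsub>ell1_N_min\<^esub> e_n n"
    unfolding ell1_N_min_def by (rule N_min.conv_commute) (simp add: min.commute)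
  then show "e_n n \<otimes>\<^bsub>ell1_N_min\<^esub> a = phi_n n a \<odot>\<^bsub>ell1_N_min\<^esub> e_n n"
    using * by simp
qed

section \<open>The ideals \<open>I_n\<close> and their quotients\<close>

lemma lin_subspace_supported:
  "lin_subspace N_min.L {f \<in> carrier N_min.L. \<forall>s>n. f s = 0}"
  by (rule N_min.L.lin_subspaceI)
    (auto simp: N_min.add_mem_L N_min.scale_mem_L N_min.mem_L_iff[of "\<lambda>s. 0"])

text \<open>A pair with min u v = s > n has v > n, so every term of the convolution at s
  vanishes.\<close>

lemma conv_supported:
  assumes "\<forall>s>n. g s = 0" "s > n"
  shows "(f \<otimes>\<^bsub>N_min.L\<^esub> g) s = 0"
  unfolding N_min.conv_eq using assms by (intro infsum_0) auto

text \<open>The functions on the right form an ideal containing the generators; conversely each of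
  them is a finite linear combination of the generators, hence lies in every ideal containing
  these.\<close>

lemma I_n_eq: "I_n n = {f \<in> carrier N_min.L. \<forall>s>n. f s = 0}" (is "_ = ?J")
proof
  have "alg_ideal N_min.L ?J"
    unfolding alg_ideal_def
  proof (intro conjI ballI)
    show "lin_subspace N_min.L ?J" by (rule lin_subspace_supported)
    fix a x assume a: "a \<in> carrier N_min.L" and x: "x \<in> ?J"
    then show *: "a \<otimes>\<^bsub>N_min.L\<^esub> x \<in> ?J"
      using conv_supported[of n x] N_min.conv_mem_L by auto
    have "x \<otimes>\<^bsub>N_min.L\<^esub> a = a \<otimes>\<^bsub>N_min.L\<^esub> x"
      by (rule N_min.conv_commute) (simp add: min.commute)
    with * show "x \<otimes>\<^bsub>N_min.L\<^esub> a \<in> ?J" by simp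
  qed
  moreover have "point_mass ` {1..n} \<subseteq> ?J"
    using N_min.point_mass_mem_L by (auto simp: point_mass_def)
  ultimately show "I_n n \<subseteq> ?J"
    unfolding I_n_def ideal_generated_def ell1_N_min_def by (intro hull_minimal)
  show "?J \<subseteq> I_n n"
  proof
    fix f assume f: "f \<in> ?J"
    have "f \<in> I" if I: "alg_ideal N_min.L I" and pm: "point_mass ` {1..n} \<subseteq> I" for I
    proof -
      have "lin_subspace N_min.L I" using I by (simp add: alg_ideal_def)
      note D = N_min.L.lin_subspaceD[OF this]
      have "k \<le> n \<Longrightarrow> (\<lambda>s. if s \<le> k then f s else 0) \<in> I" for k
      proof (induction k)
        \<comment> \<open>The index 0 lies outside \<open>{1..}\<close>, so f(0) = 0 and the first
          truncation is the zero function.\<close>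
        case 0
        have "(\<lambda>s. if s \<le> 0 then f s else 0) = \<zero>\<^bsub>N_min.L\<^esub>"
          using N_min.L_off[of f 0] f by auto
        then show ?case using D(2) by simp
      next
        case (Suc k)
        have "(\<lambda>s. if s \<le> Suc k then f s else 0) =
            (\<lambda>s. if s \<le> k then f s else 0) \<oplus>\<^bsub>N_min.L\<^esub> (f (Suc k) \<odot>\<^bsub>N_min.L\<^esub> point_mass (Suc k))"
          by (auto simp: fun_eq_iff point_mass_def le_Suc_eq)
        moreover have "point_mass (Suc k) \<in> I" using pm Suc.prems by auto
        ultimately show ?case using Suc D(3,6) by simp
      qed
      moreover have "(\<lambda>s. if s \<le> n then f s else 0) = f"
        using f by (auto simp: fun_eq_iff)
      ultimately show "f \<in> I" by (metis order_refl)
    qed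
    then show "f \<in> I_n n"
      unfolding I_n_def ideal_generated_def ell1_N_min_def hull_def by blast
  qed
qed

text \<open>\<open>I_n n\<close> is the common kernel of the evaluations at points s > n, and
  \<open>norm_le_nrm_L\<close> makes each evaluation continuous.\<close>

lemma closed_subspace_I_n: "closed_subspace N_min.L (I_n n)"
proof (rule N_min.L.closed_subspaceI)
  show "lin_subspace N_min.L (I_n n)"
    unfolding I_n_eq by (rule lin_subspace_supported)
  fix F l assume F: "\<And>k. F k \<in> I_n n" and l: "l \<in> carrier N_min.L"
    and lim: "(\<lambda>k. nrm N_min.L (F k \<ominus>\<^bsub>N_min.L\<^esub> l)) \<longlonglongrightarrow> 0"
  have "l s = 0" if s: "s > n" for s
  proof -
    have "norm (l s) \<le> nrm N_min.L (F k \<ominus>\<^bsub>N_min.L\<^esub> l)" for k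
    proof -
      have Fk: "F k \<in> carrier N_min.L" "F k s = 0" using F[of k] s by (auto simp: I_n_eq)
      then show ?thesis
        using N_min.norm_le_nrm_L[of "F k \<ominus>\<^bsub>N_min.L\<^esub> l" s] l
        by (simp add: N_min.minus_L N_min.diff_mem_L)
    qed
    then have "norm (l s) \<le> 0" using LIMSEQ_le_const[OF lim] by blast
    then show ?thesis by simp
  qed
  then show "l \<in> I_n n" using l by (simp add: I_n_eq)
qed

lemma banach_left_module_quotient_I_n:
  "banach_left_module ell1_N_min (quotient_module (regular_module ell1_N_min) (I_n n))"
proof -
  interpret banach_left_module N_min.L "regular_module N_min.L"
    by (rule banach_left_module_regular[OF N_min.banach_algebra_L])
  interpret closed_submodule N_min.L "regular_module N_min.L" "I_n n"
  proof
    show "closed_subspace (regular_module N_min.L) (I_n n)"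
      by (rule closed_subspace_regular[OF N_min.normed_vs_L closed_subspace_I_n])
    show "act (regular_module N_min.L) a x \<in> I_n n" if "a \<in> carrier N_min.L" "x \<in> I_n n" for a x
      using that N_min.conv_mem_L conv_supported[of n x] by (simp add: I_n_eq)
  qed
  show ?thesis unfolding ell1_N_min_def by (rule banach_left_module_Q)
qed

theorem theorem3p2:
  shows "(\<forall>n::nat. 1 \<le> n \<longrightarrow>
           phi_injective TYPE('f) TYPE('k) ell1_N_min (phi_n n)
             (quotient_module (regular_module ell1_N_min) (I_n n))) \<and>
         (\<forall>n::nat. 1 \<le> n \<longrightarrow>
           phi_injective TYPE('f) TYPE('k) ell1_N_min (phi_n n)
             (regular_module ell1_N_min))"
proof (intro conjI allI impI)
  fix n :: nat assume n: "1 \<le> n"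
  show "phi_injective TYPE('f) TYPE('k) ell1_N_min (phi_n n)
      (quotient_module (regular_module ell1_N_min) (I_n n))"
    by (rule phi_n_injective[OF n banach_left_module_quotient_I_n])
  have "banach_left_module ell1_N_min (regular_module ell1_N_min)"
    unfolding ell1_N_min_def by (rule banach_left_module_regular[OF N_min.banach_algebra_L])
  then show "phi_injective TYPE('f) TYPE('k) ell1_N_min (phi_n n) (regular_module ell1_N_min)"
    by (rule phi_n_injective[OF n])
qed

end
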